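(* Let $\mathcal O$ and its Witt vector functor $W$ be as in the context, let $i\in\mathbb N\cup\{\infty\}$, and let $A$ be an $\mathcal O_i$-algebra, viewed as an $\mathcal O$-algebra via the surjection $\mathrm{ev}_i:\mathcal O\to\mathcal O_i$. Then the $\mathcal O$-algebra $W(A)$ is naturally isomorphic to the ring $W_i(A)$ of $\mathcal O_i$-typical Witt vectors of $A$.
   Context: Let $q$ be a power of a prime $p$. $\{E_i\}_{i\in\mathbb N}$ are characteristic-0 nonarchimedean local fields with residue field $\mathbb F_q$, rings of integers $\mathcal O_i$, maximal ideals $\mathfrak p_i$, and absolute ramification indices $e_i\to\infty$. $E_\infty=\mathbb F_q((t))$. Isomorphisms $\mathrm{Tr}_{e_i}(E_i)\cong\mathrm{Tr}_{e_i}(E_\infty)$ of Deligne triples $\mathrm{Tr}_m(L)=(\mathcal O_L/\mathfrak p_L^m,\mathfrak p_L/\mathfrak p_L^{m+1},\text{natural map})$ are fixed, in particular ring isomorphisms $\mathcal O_i/\mathfrak p_i^{e_i}\cong\mathcal O_\infty/\mathfrak p_\infty^{e_i}$. $\pi_\infty=t$, and $\pi_i$ is a uniformizer of $E_i$ matching $t$ mod $\mathfrak p^{e_i}$. $\mathcal O$ is the ring of families $(f_i)_{i\in\mathbb N\cup\{\infty\}}$ with $f_i\in\mathcal O_i$ such that, for every $n\ge1$, for all large enough $i$ the image of $f_i$ in $\mathcal O_i/\mathfrak p_i^n\cong\mathcal O_\infty/\mathfrak p_\infty^n$ equals the image of $f_\infty$. $\pi=(\pi_i)_i\in\mathcal O$,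 and $\mathrm{ev}_i((f_k)_k)=f_i$. $W:\{\mathcal O\text{-algebras}\}\to\{\mathcal O\text{-algebras}\}$ is the unique functor whose underlying set-valued functor is $A\mapsto\{\text{sequences }(a_0,a_1,\dots)\text{ in }A\}$ and such that all the maps $w_j:W(A)\to A$, $w_j(a_0,a_1,\dots)=a_0^{q^j}+\pi a_1^{q^{j-1}}+\cdots+\pi^ja_j$, are $\mathcal O$-algebra homomorphisms. $W_i$ is Drinfeld's functor of $\mathcal O_i$-typical (ramified) Witt vectors: the unique functor from $\mathcal O_i$-algebras to $\mathcal O_i$-algebras with underlying set-valued functor $A\mapsto A^{\mathbb N}$ for which the maps $(a_0,a_1,\dots)\mapsto a_0^{q^j}+\pi_ia_1^{q^{j-1}}+\cdots+\pi_i^ja_j$ are $\mathcal O_i$-algebra homomorphisms. *)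

theory Defs
  imports
    "HOL-Algebra.Module"
    "HOL-Algebra.QuotRing"
    "HOL-Algebra.Ideal_Product"
    "HOL-Algebra.Algebraic_Closure_Type"
    "HOL-Computational_Algebra.Formal_Laurent_Series"
    "HOL-Library.Extended_Nat"
    "HOL-Library.Equipollence"
begin

section \<open>Nonarchimedean local fields\<close>

definition val_ring :: "'a ring \<Rightarrow> ('a \<Rightarrow> int) \<Rightarrow> 'a ring" where
  "val_ring L v = L\<lparr>carrier := {x \<in> carrier L. x = \<zero>\<^bsub>L\<^esub> \<or> 0 \<le> v x}\<rparr>"

definition val_ideal :: "'a ring \<Rightarrow> ('a \<Rightarrow> int) \<Rightarrow> 'a set" where
  "val_ideal L v = {x \<in> carrier L. x = \<zero>\<^bsub>L\<^esub> \<or> 0 < v x}"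

abbreviation ideal_power :: "'a ring \<Rightarrow> 'a set \<Rightarrow> nat \<Rightarrow> 'a set" where
  "ideal_power R P n \<equiv> P [^]\<^bsub>ideals_set R\<^esub> n"

definition val_close :: "'a ring \<Rightarrow> ('a \<Rightarrow> int) \<Rightarrow> int \<Rightarrow> 'a \<Rightarrow> 'a \<Rightarrow> bool" where
  "val_close L v N x y \<longleftrightarrow> x = y \<or> N \<le> v (x \<ominus>\<^bsub>L\<^esub> y)"

text \<open>A nonarchimedean local field is a field complete with respect to a discrete valuation with
  finite residue field; \<open>v\<close> is its normalized valuation, whose value at zero is irrelevant.\<close>

locale nonarch_local_field = Ring.field L for L :: "'a ring" (structure) +
  fixes v :: "'a \<Rightarrow> int"
  assumes val_mult:
      "\<lbrakk>x \<in> carrier L - {\<zero>}; y \<in> carrier L - {\<zero>}\<rbrakk> \<Longrightarrow> v (x \<otimes> y) = v x + v y"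
    and val_add:
      "\<lbrakk>x \<in> carrier L - {\<zero>}; y \<in> carrier L - {\<zero>}; x \<oplus> y \<noteq> \<zero>\<rbrakk>
        \<Longrightarrow> min (v x) (v y) \<le> v (x \<oplus> y)"
    and val_normalized: "\<exists>x \<in> carrier L - {\<zero>}. v x = 1"
    and complete:
      "\<lbrakk>\<And>n::nat. s n \<in> carrier L; \<And>N. \<exists>M. \<forall>m\<ge>M. \<forall>n\<ge>M. val_close L v N (s m) (s n)\<rbrakk>
        \<Longrightarrow> \<exists>l \<in> carrier L. \<forall>N. \<exists>M. \<forall>n\<ge>M. val_close L v N (s n) l"
    and finite_residue_field: "finite (carrier (val_ring L v Quot val_ideal L v))"

section \<open>Deligne triples\<close>

text \<open>The second entry \<open>P/P\<^sup>m\<^sup>+\<^sup>1\<close> of the triple of \<open>(R, P)\<close>. It is an \<open>R/P\<^sup>m\<close>-module: the product of a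
  class \<open>C\<close> modulo \<open>P\<^sup>m\<close> with a class \<open>U\<close> modulo \<open>P\<^sup>m\<^sup>+\<^sup>1\<close> of elements of \<open>P\<close> is
  \<open>rcoset_mult R (P\<^sup>m\<^sup>+\<^sup>1) C U\<close>. The natural map to \<open>R/P\<^sup>m\<close> sends \<open>U\<close> to \<open>P\<^sup>m + U\<close>.\<close>

definition deligne_module :: "'a ring \<Rightarrow> 'a set \<Rightarrow> nat \<Rightarrow> 'a set set" where
  "deligne_module R P m = (\<lambda>x. ideal_power R P (Suc m) +>\<^bsub>R\<^esub> x) ` P"

definition deligne_iso ::
  "nat \<Rightarrow> 'a ring \<Rightarrow> 'a set \<Rightarrow> 'b ring \<Rightarrow> 'b set \<Rightarrow> ('a set \<Rightarrow> 'b set) \<Rightarrow> ('a set \<Rightarrow> 'b set) \<Rightarrow> bool"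
  where
  "deligne_iso m R P S Q \<phi> \<psi> \<longleftrightarrow>
     \<phi> \<in> ring_iso (R Quot ideal_power R P m) (S Quot ideal_power S Q m) \<and>
     bij_betw \<psi> (deligne_module R P m) (deligne_module S Q m) \<and>
     (\<forall>U \<in> deligne_module R P m. \<forall>V \<in> deligne_module R P m.
        \<psi> (U <+>\<^bsub>R\<^esub> V) = \<psi> U <+>\<^bsub>S\<^esub> \<psi> V) \<and>
     (\<forall>C \<in> carrier (R Quot ideal_power R P m). \<forall>U \<in> deligne_module R P m.
        \<psi> (rcoset_mult R (ideal_power R P (Suc m)) C U) =
          rcoset_mult S (ideal_power S Q (Suc m)) (\<phi> C) (\<psi> U)) \<and>
     (\<forall>U \<in> deligne_module R P m.
        \<phi> (ideal_power R P m <+>\<^bsub>R\<^esub> U) = ideal_power S Q m <+>\<^bsub>S\<^esub> \<psi> U)"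

section \<open>Local fields approximating a Laurent series field\<close>

text \<open>All fields have carriers in one type so that they form a family; \<open>E \<infinity>\<close> is identified with the
  field of Laurent series over \<open>'k\<close>, a field with \<open>q\<close> elements, by \<open>\<iota>\<close>. The \<open>e i\<close> are the absolute
  ramification indices, \<open>\<phi> i\<close> and \<open>\<psi> i\<close> the components of the isomorphisms of Deligne triples, and
  \<open>\<pi>\<close> is the family of uniformizers.\<close>

locale close_local_fields =
  fixes p q :: nat
    and E :: "enat \<Rightarrow> 'a ring"
    and v :: "enat \<Rightarrow> 'a \<Rightarrow> int"
    and \<iota> :: "'k :: {field, finite} fls \<Rightarrow> 'a"
    and e :: "nat \<Rightarrow> nat"
    and \<phi> \<psi> :: "nat \<Rightarrow> 'a set \<Rightarrow> 'a set"
    and \<pi> :: "enat \<Rightarrow> 'a"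
  assumes prime_p: "prime p"
    and q_power: "\<exists>r>0. q = p ^ r"
    and card_k: "card (UNIV :: 'k set) = q"
    and local_field: "nonarch_local_field (E j) (v j)"
    and char_0: "0 < n \<Longrightarrow> [(n::nat)] \<cdot>\<^bsub>E (enat i)\<^esub> \<one>\<^bsub>E (enat i)\<^esub> \<noteq> \<zero>\<^bsub>E (enat i)\<^esub>"
    and residue_field:
      "val_ring (E (enat i)) (v (enat i)) Quot val_ideal (E (enat i)) (v (enat i))
        \<simeq> (ring_of_type_algebra :: 'k ring)"
    and ramification: "v (enat i) ([p] \<cdot>\<^bsub>E (enat i)\<^esub> \<one>\<^bsub>E (enat i)\<^esub>) = int (e i)"
    and ramification_tendsto: "filterlim e at_top sequentially"
    and laurent: "\<iota> \<in> ring_iso (ring_of_type_algebra :: 'k fls ring) (E \<infinity>)"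
    and laurent_val: "f \<noteq> 0 \<Longrightarrow> v \<infinity> (\<iota> f) = fls_subdegree f"
    and deligne:
      "deligne_iso (e i)
        (val_ring (E (enat i)) (v (enat i))) (val_ideal (E (enat i)) (v (enat i)))
        (val_ring (E \<infinity>) (v \<infinity>)) (val_ideal (E \<infinity>) (v \<infinity>)) (\<phi> i) (\<psi> i)"
    and unif_infinity: "\<pi> \<infinity> = \<iota> fls_X"
    and unif:
      "\<pi> (enat i) \<in> carrier (E (enat i)) - {\<zero>\<^bsub>E (enat i)\<^esub>}" "v (enat i) (\<pi> (enat i)) = 1"
    and unif_match:
      "\<phi> i (ideal_power (val_ring (E (enat i)) (v (enat i))) (val_ideal (E (enat i)) (v (enat i))) (e i)
             +>\<^bsub>val_ring (E (enat i)) (v (enat i))\<^esub> \<pi> (enat i))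
        = ideal_power (val_ring (E \<infinity>) (v \<infinity>)) (val_ideal (E \<infinity>) (v \<infinity>)) (e i)
             +>\<^bsub>val_ring (E \<infinity>) (v \<infinity>)\<^esub> \<pi> \<infinity>"

text \<open>The image of \<open>x \<in> O\<^sub>i\<close> under \<open>O\<^sub>i \<rightarrow> O\<^sub>i/P\<^sub>i\<^sup>n \<cong> O\<^sub>\<infinity>/P\<^sub>\<infinity>\<^sup>n\<close> for \<open>n \<le> e\<^sub>i\<close>, where the isomorphism is
  the one induced by \<open>\<phi>\<^sub>i\<close>; it is computed as \<open>O\<^sub>i \<rightarrow> O\<^sub>i/P\<^sub>i\<^sup>e \<cong> O\<^sub>\<infinity>/P\<^sub>\<infinity>\<^sup>e \<rightarrow> O\<^sub>\<infinity>/P\<^sub>\<infinity>\<^sup>n\<close> with \<open>e = e\<^sub>i\<close>.\<close>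

definition transfer_image ::
  "(enat \<Rightarrow> 'a ring) \<Rightarrow> (enat \<Rightarrow> 'a \<Rightarrow> int) \<Rightarrow> (nat \<Rightarrow> nat) \<Rightarrow> (nat \<Rightarrow> 'a set \<Rightarrow> 'a set)
    \<Rightarrow> nat \<Rightarrow> nat \<Rightarrow> 'a \<Rightarrow> 'a set" where
  "transfer_image E v e \<phi> i n x =
     ideal_power (val_ring (E \<infinity>) (v \<infinity>)) (val_ideal (E \<infinity>) (v \<infinity>)) n
       <+>\<^bsub>val_ring (E \<infinity>) (v \<infinity>)\<^esub>
     \<phi> i (ideal_power (val_ring (E (enat i)) (v (enat i))) (val_ideal (E (enat i)) (v (enat i))) (e i)
            +>\<^bsub>val_ring (E (enat i)) (v (enat i))\<^esub> x)"

definition family_ring ::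
  "(enat \<Rightarrow> 'a ring) \<Rightarrow> (enat \<Rightarrow> 'a \<Rightarrow> int) \<Rightarrow> (nat \<Rightarrow> nat) \<Rightarrow> (nat \<Rightarrow> 'a set \<Rightarrow> 'a set)
    \<Rightarrow> (enat \<Rightarrow> 'a) ring" where
  "family_ring E v e \<phi> =
     \<lparr>carrier = {f. (\<forall>i. f i \<in> carrier (val_ring (E i) (v i))) \<and>
         (\<forall>n\<ge>1. \<exists>N. \<forall>i\<ge>N. n \<le> e i \<and>
            transfer_image E v e \<phi> i n (f (enat i)) =
              ideal_power (val_ring (E \<infinity>) (v \<infinity>)) (val_ideal (E \<infinity>) (v \<infinity>)) n
                +>\<^bsub>val_ring (E \<infinity>) (v \<infinity>)\<^esub> f \<infinity>)},
      monoid.mult = (\<lambda>f g i. f i \<otimes>\<^bsub>val_ring (E i) (v i)\<^esub> g i),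
      one = (\<lambda>i. \<one>\<^bsub>val_ring (E i) (v i)\<^esub>),
      ring.zero = (\<lambda>i. \<zero>\<^bsub>val_ring (E i) (v i)\<^esub>),
      add = (\<lambda>f g i. f i \<oplus>\<^bsub>val_ring (E i) (v i)\<^esub> g i)\<rparr>"

definition ev :: "enat \<Rightarrow> (enat \<Rightarrow> 'a) \<Rightarrow> 'a" where
  "ev i f = f i"

section \<open>Algebras and Witt vector functors\<close>

definition alg_hom :: "'r ring \<Rightarrow> ('r, 'a) module \<Rightarrow> ('r, 'b) module \<Rightarrow> ('a \<Rightarrow> 'b) set" where
  "alg_hom R A B =
     {h \<in> ring_hom A B. \<forall>r \<in> carrier R. \<forall>x \<in> carrier A. h (r \<odot>\<^bsub>A\<^esub> x) = r \<odot>\<^bsub>B\<^esub> h x}"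

definition alg_iso :: "'r ring \<Rightarrow> ('r, 'a) module \<Rightarrow> ('r, 'b) module \<Rightarrow> ('a \<Rightarrow> 'b) set" where
  "alg_iso R A B = {h \<in> alg_hom R A B. bij_betw h (carrier A) (carrier B)}"

definition restrict_scalars :: "('s \<Rightarrow> 'r) \<Rightarrow> ('r, 'a) module \<Rightarrow> ('s, 'a) module" where
  "restrict_scalars \<sigma> A =
     \<lparr>carrier = carrier A, monoid.mult = monoid.mult A, one = monoid.one A,
      ring.zero = ring.zero A, add = add A, module.smult = (\<lambda>s x. \<sigma> s \<odot>\<^bsub>A\<^esub> x)\<rparr>"

definition ghost :: "'r ring \<Rightarrow> 'r \<Rightarrow> nat \<Rightarrow> ('r, 'a) module \<Rightarrow> nat \<Rightarrow> (nat \<Rightarrow> 'a) \<Rightarrow> 'a" where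
  "ghost R \<pi> q A j a =
     (\<Oplus>\<^bsub>A\<^esub>k\<in>{..j}. (\<pi> [^]\<^bsub>R\<^esub> k) \<odot>\<^bsub>A\<^esub> (a k [^]\<^bsub>A\<^esub> (q ^ (j - k))))"

text \<open>\<open>W\<close> is a functor from \<open>R\<close>-algebras to \<open>R\<close>-algebras with underlying set functor
  \<open>A \<mapsto> A\<^sup>\<nat>\<close> for which all ghost maps are \<open>R\<close>-algebra homomorphisms. The algebras range over those
  with carrier in the type \<open>'u\<close>, which plays the role of a universe; these properties determine
  \<open>W\<close> only if \<open>'u\<close> is large enough to contain a copy of \<open>R\<close>, hence of \<open>R[X\<^sub>0, X\<^sub>1, \<dots>]\<close> when \<open>R\<close> is
  infinite.\<close>

definition witt_functor ::
  "'r ring \<Rightarrow> 'r \<Rightarrow> nat \<Rightarrow> (('r, 'u) module \<Rightarrow> ('r, nat \<Rightarrow> 'u) module) \<Rightarrow> bool" where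
  "witt_functor R \<pi> q W \<longleftrightarrow>
     (\<forall>A. algebra R A \<longrightarrow>
        algebra R (W A) \<and>
        carrier (W A) = {a. \<forall>n. a n \<in> carrier A} \<and>
        (\<forall>j. ghost R \<pi> q A j \<in> alg_hom R (W A) A)) \<and>
     (\<forall>A B h. algebra R A \<longrightarrow> algebra R B \<longrightarrow> h \<in> alg_hom R A B \<longrightarrow>
        (\<lambda>a n. h (a n)) \<in> alg_hom R (W A) (W B))"

end

theory Submission
  imports Defs
begin

text \<open>The isomorphism is the identity on sequences. If \<open>B\<close> is an \<open>O\<^sub>i\<close>-algebra on which \<open>\<pi>\<^sub>i\<close> is not
  a zero divisor, then the ghost maps, which are the same for \<open>W(B)\<close> and \<open>W\<^sub>i(B)\<close>, are jointly
  injective, so the two structures agree. Any two sequences in an \<open>O\<^sub>i\<close>-algebra \<open>A\<close> are the images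
  of sequences of variables under a homomorphism from \<open>O\<^sub>i[X\<^sub>0, X\<^sub>1, \<dots>]\<close>, so by functoriality the
  structures agree on \<open>A\<close> as well. The polynomial ring fits into the universe since \<open>ev\<^sub>i\<close> is
  surjective and \<open>O\<^sub>i\<close> is infinite.\<close>

section \<open>Polynomial algebras in countably many variables\<close>

text \<open>Witt vector addition is usually given by polynomials whose integrality has to be proved.
  Here both functors are given, so only the uniqueness of their operations is at stake, and no Witt
  polynomial is written down. On an algebra where the uniformizer kills something, such as the
  residue field, ghost components do not determine a sequence; hence the detour through a free
  algebra. Its base is the ring of integers at i and not the ring of families: the latter has zero
  divisors, while the former is a domain with \<pi>_i nonzero. The case i = \<infinity> needs no
  separate treatment, because the argument cancels powers of \<pi>_i and never p. The obstacle is
  size. A functor here is a function on algebras with carrier in the fixed type \<open>'u\<close>,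
  so neither functor can be applied to a polynomial algebra before that algebra has been copied into
  \<open>'u\<close>. Representing polynomials by expression trees serves this purpose too: trees are
  easy to code by nested pairs, and each polynomial comes from a tree.\<close>

text \<open>A polynomial is a coefficient function on monomials, the latter being multisets of indices of
  variables. Expressions act on all coefficient functions by multiplication, \<open>poly_of t\<close> is what
  \<open>t\<close> makes of the constant polynomial 1, and \<open>poly_of s \<cdot> p\<close> is the action of \<open>s\<close> on \<open>p\<close>. Since
  the actions commute, this depends on \<open>poly_of s\<close> alone, and no convolution sums occur.\<close>

datatype (expr_consts: 'r) expr =
  Const 'r | Var nat | Plus "'r expr" "'r expr" | Times "'r expr" "'r expr"

context cring
begin

primrec act :: "'a expr \<Rightarrow> (nat multiset \<Rightarrow> 'a) \<Rightarrow> nat multiset \<Rightarrow> 'a" where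
  "act (Const r) f = (\<lambda>m. r \<otimes> f m)"
| "act (Var n) f = (\<lambda>m. if n \<in># m then f (m - {#n#}) else \<zero>)"
| "act (Plus s t) f = (\<lambda>m. act s f m \<oplus> act t f m)"
| "act (Times s t) f = act s (act t f)"

definition poly_of :: "'a expr \<Rightarrow> nat multiset \<Rightarrow> 'a" where
  "poly_of t = act t (\<lambda>m. if m = {#} then \<one> else \<zero>)"

text \<open>Taking values of expressions as the carrier replaces a finite support condition, which
  becomes a consequence (\<open>finite_supp_act\<close>), and lets each ring axiom be checked on
  expressions.\<close>

definition poly_alg :: "('a, nat multiset \<Rightarrow> 'a) module" where
  "poly_alg =
     \<lparr>carrier = poly_of ` {t. expr_consts t \<subseteq> carrier R},
      monoid.mult = (\<lambda>p. act (SOME t. expr_consts t \<subseteq> carrier R \<and> poly_of t = p)),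
      one = poly_of (Const \<one>),
      ring.zero = (\<lambda>m. \<zero>),
      add = (\<lambda>p q m. p m \<oplus> q m),
      module.smult = (\<lambda>r p m. r \<otimes> p m)\<rparr>"

lemma act_closed:
  assumes "expr_consts t \<subseteq> carrier R" "\<And>m. f m \<in> carrier R"
  shows "act t f m \<in> carrier R"
  using assms by (induction t arbitrary: f m) auto

text \<open>Together with \<open>act_smult\<close> this makes every action linear, as the cases
  \<open>Plus\<close> and \<open>Const\<close> of \<open>act_commute\<close> require.\<close>

lemma act_add:
  assumes "expr_consts t \<subseteq> carrier R" "\<And>m. f m \<in> carrier R" "\<And>m. g m \<in> carrier R"
  shows "act t (\<lambda>m. f m \<oplus> g m) = (\<lambda>m. act t f m \<oplus> act t g m)"
  using assms
proof (induction t arbitrary: f g)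
  case (Plus s t)
  then show ?case
    by (auto simp: fun_eq_iff act_closed a_ac)
next
  case (Times s t)
  then show ?case by (simp add: act_closed)
qed (auto simp: r_distr)

lemma act_smult:
  assumes "expr_consts t \<subseteq> carrier R" "\<And>m. f m \<in> carrier R" "r \<in> carrier R"
  shows "act t (\<lambda>m. r \<otimes> f m) = (\<lambda>m. r \<otimes> act t f m)"
  using assms
  by (induction t arbitrary: f) (auto simp: act_closed r_distr m_lcomm)

lemma act_Var_commute:
  assumes "expr_consts t \<subseteq> carrier R" "\<And>m. f m \<in> carrier R"
  shows "act t (act (Var n) f) = act (Var n) (act t f)"
  using assms
proof (induction t arbitrary: f)
  case (Var k)
  \<comment> \<open>Removing k and then n from m is possible exactly when the reverse order is; for
    k = n both ask for multiplicity at least two.\<close>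
  have "k \<in># m \<and> n \<in># m - {#k#} \<longleftrightarrow> n \<in># m \<and> k \<in># m - {#n#}" for m
    by (cases "k = n") (auto simp: in_diff_count)
  then show ?case
    by (auto simp: fun_eq_iff diff_diff_add_mset add_mset_commute)
next
  case (Times s t)
  have "act (Times s t) (act (Var n) f) = act s (act (Var n) (act t f))"
    using Times by simp
  also have "\<dots> = act (Var n) (act s (act t f))"
    using Times by (intro Times.IH) (auto simp: act_closed)
  finally show ?case by simp
qed (auto simp: fun_eq_iff)

text \<open>Induction on s alone reduces the claim to scalars, which commute with t by linearity,
  and to variables, which are \<open>act_Var_commute\<close>.\<close>

lemma act_commute:
  assumes "expr_consts s \<subseteq> carrier R" "expr_consts t \<subseteq> carrier R" "\<And>m. f m \<in> carrier R"
  shows "act s (act t f) = act t (act s f)"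
  using assms
proof (induction s arbitrary: f)
  case (Const r)
  then show ?case by (simp add: act_smult)
next
  case (Var n)
  then show ?case using act_Var_commute by metis
next
  case (Plus s1 s2)
  then show ?case by (simp add: act_add act_closed)
next
  case (Times s1 s2)
  then show ?case by (simp add: act_closed)
qed

lemma poly_of_closed: "expr_consts t \<subseteq> carrier R \<Longrightarrow> poly_of t m \<in> carrier R"
  by (simp add: poly_of_def act_closed)

lemma act_poly_of: "act s (poly_of t) = poly_of (Times s t)"
  by (simp add: poly_of_def)

text \<open>The expression u picked by \<open>SOME\<close> may differ from s; it is only known to
  have the same polynomial. Moving it past t makes it act on 1, where it can be exchanged for s: u t
  1 = t u 1 = t s 1 = s t 1.\<close>

lemma poly_alg_mult:
  assumes "expr_consts s \<subseteq> carrier R" "expr_consts t \<subseteq> carrier R"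
  shows "poly_of s \<otimes>\<^bsub>poly_alg\<^esub> poly_of t = poly_of (Times s t)"
proof -
  define u where "u = (SOME u. expr_consts u \<subseteq> carrier R \<and> poly_of u = poly_of s)"
  have u: "expr_consts u \<subseteq> carrier R \<and> poly_of u = poly_of s"
    unfolding u_def by (rule someI[of _ s]) (use assms in simp)
  have "act u (poly_of t) = act t (poly_of u)"
    using u assms unfolding poly_of_def by (intro act_commute) auto
  also have "\<dots> = act t (poly_of s)"
    using u by simp
  also have "\<dots> = act s (poly_of t)"
    using assms unfolding poly_of_def by (intro act_commute) auto
  finally show ?thesis
    by (simp add: poly_alg_def u_def act_poly_of)
qed

lemma poly_of_times_commute:
  assumes "expr_consts s \<subseteq> carrier R" "expr_consts t \<subseteq> carrier R"
  shows "poly_of (Times s t) = poly_of (Times t s)"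
  using assms by (simp add: poly_of_def act_commute)

lemma poly_alg_add: "poly_of s \<oplus>\<^bsub>poly_alg\<^esub> poly_of t = poly_of (Plus s t)"
  by (simp add: poly_alg_def poly_of_def)

lemma poly_alg_smult: "r \<odot>\<^bsub>poly_alg\<^esub> poly_of t = poly_of (Times (Const r) t)"
  by (simp add: poly_alg_def poly_of_def)

lemma poly_alg_zero: "\<zero>\<^bsub>poly_alg\<^esub> = poly_of (Const \<zero>)"
  by (simp add: poly_alg_def poly_of_def fun_eq_iff)

lemma poly_alg_one: "\<one>\<^bsub>poly_alg\<^esub> = poly_of (Const \<one>)"
  by (simp add: poly_alg_def)

lemma poly_alg_carrierE:
  assumes "p \<in> carrier poly_alg"
  obtains t where "expr_consts t \<subseteq> carrier R" "p = poly_of t"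
  using assms by (auto simp: poly_alg_def)

lemma poly_of_in_carrier: "expr_consts t \<subseteq> carrier R \<Longrightarrow> poly_of t \<in> carrier poly_alg"
  by (auto simp: poly_alg_def)

lemmas poly_alg_ops = poly_alg_mult poly_alg_add poly_alg_smult poly_alg_zero poly_alg_one

text \<open>Associativity is built in, since \<open>Times\<close> acts by composition, and
  commutativity is \<open>act_commute\<close>.\<close>

lemma poly_alg_algebra: "algebra R poly_alg"
proof (rule algebraI)
  show "cring poly_alg"
  proof (rule cringI)
    show "abelian_group poly_alg"
    proof (rule abelian_groupI)
      fix p assume "p \<in> carrier poly_alg"
      then obtain t where t: "expr_consts t \<subseteq> carrier R" "p = poly_of t"
        by (rule poly_alg_carrierE)
      \<comment> \<open>Expressions have no negation, so the inverse is the product with the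
        constant -1.\<close>
      have "poly_of (Times (Const (\<ominus> \<one>)) t) \<oplus>\<^bsub>poly_alg\<^esub> p = \<zero>\<^bsub>poly_alg\<^esub>"
        unfolding t(2) poly_alg_add poly_alg_zero
        using t(1) by (simp add: poly_of_def fun_eq_iff act_closed l_minus l_neg)
      then show "\<exists>y\<in>carrier poly_alg. y \<oplus>\<^bsub>poly_alg\<^esub> p = \<zero>\<^bsub>poly_alg\<^esub>"
        by (rule bexI[OF _ poly_of_in_carrier]) (use t(1) in auto)
    qed (auto elim!: poly_alg_carrierE simp: poly_alg_ops poly_of_in_carrier,
         auto simp: poly_of_def act_closed a_ac)
  next
    show "comm_monoid poly_alg"
    proof (rule comm_monoidI)
      fix p q assume "p \<in> carrier poly_alg" "q \<in> carrier poly_alg"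
      then show "p \<otimes>\<^bsub>poly_alg\<^esub> q = q \<otimes>\<^bsub>poly_alg\<^esub> p"
        by (auto elim!: poly_alg_carrierE simp: poly_alg_ops intro: poly_of_times_commute)
    qed (auto elim!: poly_alg_carrierE simp: poly_alg_ops poly_of_in_carrier,
         auto simp: poly_of_def act_closed)
  qed (auto elim!: poly_alg_carrierE simp: poly_alg_ops, auto simp: poly_of_def)
qed (use is_cring in \<open>auto elim!: poly_alg_carrierE simp: poly_alg_ops poly_of_in_carrier\<close>,
     auto simp: poly_of_def act_closed l_distr r_distr m_assoc act_smult)

lemma finite_supp_act:
  assumes "expr_consts t \<subseteq> carrier R" "\<And>m. f m \<in> carrier R" "finite {m. f m \<noteq> \<zero>}"
  shows "finite {m. act t f m \<noteq> \<zero>}"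
  using assms
proof (induction t arbitrary: f)
  case (Const r)
  then show ?case
    by (elim finite_subset[rotated]) auto
next
  case (Var n)
  have "{m. act (Var n) f m \<noteq> \<zero>} \<subseteq> add_mset n ` {m. f m \<noteq> \<zero>}"
    by (auto split: if_splits intro!: image_eqI[of _ _ "_ - {#n#}"])
  then show ?case
    using Var by (meson finite_imageI finite_subset)
next
  case (Plus s t)
  have "{m. act (Plus s t) f m \<noteq> \<zero>} \<subseteq> {m. act s f m \<noteq> \<zero>} \<union> {m. act t f m \<noteq> \<zero>}"
    by auto
  then show ?case
    by (rule finite_subset) (use Plus in simp)
next
  case (Times s t)
  then show ?case by (simp add: act_closed)
qed

end

section \<open>Evaluation of polynomials in an algebra\<close>

context algebra
begin

primrec eval_expr :: "(nat \<Rightarrow> 'c) \<Rightarrow> 'a expr \<Rightarrow> 'c" where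
  "eval_expr a (Const r) = r \<odot>\<^bsub>M\<^esub> \<one>\<^bsub>M\<^esub>"
| "eval_expr a (Var n) = a n"
| "eval_expr a (Plus s t) = eval_expr a s \<oplus>\<^bsub>M\<^esub> eval_expr a t"
| "eval_expr a (Times s t) = eval_expr a s \<otimes>\<^bsub>M\<^esub> eval_expr a t"

definition eval_monom :: "(nat \<Rightarrow> 'c) \<Rightarrow> nat multiset \<Rightarrow> 'c" where
  "eval_monom a m = (\<Otimes>\<^bsub>M\<^esub>n\<in>set_mset m. a n [^]\<^bsub>M\<^esub> count m n)"

text \<open>Different expressions can denote one polynomial, so \<open>eval_expr\<close> alone gives
  no map on polynomials. This sum over coefficients is well defined from the start, and
  \<open>eval_coeffs_poly_of\<close> shows that it agrees with \<open>eval_expr\<close>.\<close>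

definition eval_coeffs :: "(nat \<Rightarrow> 'c) \<Rightarrow> (nat multiset \<Rightarrow> 'a) \<Rightarrow> 'c" where
  "eval_coeffs a f = (\<Oplus>\<^bsub>M\<^esub>m\<in>{m. f m \<noteq> \<zero>\<^bsub>R\<^esub>}. f m \<odot>\<^bsub>M\<^esub> eval_monom a m)"

lemma smult_rcomm:
  assumes "r \<in> carrier R" "x \<in> carrier M" "y \<in> carrier M"
  shows "r \<odot>\<^bsub>M\<^esub> (x \<otimes>\<^bsub>M\<^esub> y) = x \<otimes>\<^bsub>M\<^esub> (r \<odot>\<^bsub>M\<^esub> y)"
  using assms smult_assoc2[of r y x] by (simp add: m_comm)

lemma eval_expr_closed:
  assumes "\<And>n. a n \<in> carrier M" "expr_consts t \<subseteq> carrier R"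
  shows "eval_expr a t \<in> carrier M"
  using assms by (induction t) auto

lemma eval_monom_closed:
  assumes "\<And>n. a n \<in> carrier M"
  shows "eval_monom a m \<in> carrier M"
  using assms by (simp add: eval_monom_def)

lemma eval_monom_add_mset:
  assumes "\<And>n. a n \<in> carrier M"
  shows "eval_monom a (add_mset k m) = a k \<otimes>\<^bsub>M\<^esub> eval_monom a m"
proof -
  let ?S = "set_mset (add_mset k m)"
  \<comment> \<open>The extra factor \<open>a k\<close> is spread over the larger index set as a
    product with one nontrivial factor. If k does not occur in m, it contributes exponent 0 to the
    remaining product.\<close>
  have "eval_monom a (add_mset k m)
      = (\<Otimes>\<^bsub>M\<^esub>n\<in>?S. (if k = n then a n else \<one>\<^bsub>M\<^esub>) \<otimes>\<^bsub>M\<^esub> a n [^]\<^bsub>M\<^esub> count m n)"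
    unfolding eval_monom_def using assms by (intro finprod_cong') (auto simp: m_comm)
  also have "\<dots> = (\<Otimes>\<^bsub>M\<^esub>n\<in>?S. if k = n then a n else \<one>\<^bsub>M\<^esub>)
      \<otimes>\<^bsub>M\<^esub> (\<Otimes>\<^bsub>M\<^esub>n\<in>?S. a n [^]\<^bsub>M\<^esub> count m n)"
    using assms by (intro finprod_multf) auto
  also have "(\<Otimes>\<^bsub>M\<^esub>n\<in>?S. if k = n then a n else \<one>\<^bsub>M\<^esub>) = a k"
    using assms by (intro finprod_singleton) auto
  also have "(\<Otimes>\<^bsub>M\<^esub>n\<in>?S. a n [^]\<^bsub>M\<^esub> count m n) = eval_monom a m"
    unfolding eval_monom_def using assms
    by (intro finprod_mono_neutral_cong_right) (auto simp: not_in_iff)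
  finally show ?thesis .
qed

text \<open>Coefficients can cancel in a sum or be killed by a zero divisor, so supports are not
  predictable; sums are compared over a common finite superset.\<close>

lemma eval_coeffs_supset:
  assumes "\<And>n. a n \<in> carrier M" "\<And>m. f m \<in> carrier R" "finite S" "{m. f m \<noteq> \<zero>\<^bsub>R\<^esub>} \<subseteq> S"
  shows "eval_coeffs a f = (\<Oplus>\<^bsub>M\<^esub>m\<in>S. f m \<odot>\<^bsub>M\<^esub> eval_monom a m)"
  unfolding eval_coeffs_def using assms
  by (intro M.add.finprod_mono_neutral_cong_left) (auto simp: eval_monom_closed)

lemma eval_coeffs_closed:
  assumes "\<And>n. a n \<in> carrier M" "\<And>m. f m \<in> carrier R"
  shows "eval_coeffs a f \<in> carrier M"
  unfolding eval_coeffs_def using assms by (intro M.finsum_closed) (auto simp: eval_monom_closed)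

text \<open>The function f stays arbitrary because the case \<open>Times s t\<close> uses the
  hypothesis for s at \<open>R.act t f\<close>. Applied to the constant polynomial 1, the lemma
  yields \<open>eval_coeffs_poly_of\<close>.\<close>

lemma eval_coeffs_act:
  assumes a: "\<And>n. a n \<in> carrier M" and "expr_consts t \<subseteq> carrier R"
    and "\<And>m. f m \<in> carrier R" "finite {m. f m \<noteq> \<zero>\<^bsub>R\<^esub>}"
  shows "eval_coeffs a (R.act t f) = eval_expr a t \<otimes>\<^bsub>M\<^esub> eval_coeffs a f"
  using assms(2-)
proof (induction t arbitrary: f)
  case (Const r)
  let ?S = "{m. f m \<noteq> \<zero>\<^bsub>R\<^esub>}"
  have "eval_coeffs a (R.act (Const r) f)
      = (\<Oplus>\<^bsub>M\<^esub>m\<in>?S. R.act (Const r) f m \<odot>\<^bsub>M\<^esub> eval_monom a m)"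
  proof (rule eval_coeffs_supset)
    show "{m. R.act (Const r) f m \<noteq> \<zero>\<^bsub>R\<^esub>} \<subseteq> ?S"
      using Const.prems(1) by auto
  qed (use Const.prems a in simp_all)
  also have "\<dots> = (\<Oplus>\<^bsub>M\<^esub>m\<in>?S. r \<odot>\<^bsub>M\<^esub> (f m \<odot>\<^bsub>M\<^esub> eval_monom a m))"
    using Const a by (intro M.finsum_cong') (auto simp: smult_assoc1 eval_monom_closed)
  also have "\<dots> = r \<odot>\<^bsub>M\<^esub> eval_coeffs a f"
    unfolding eval_coeffs_def using Const a
    by (intro finsum_smult_ldistr[symmetric]) (auto simp: eval_monom_closed)
  also have "\<dots> = (r \<odot>\<^bsub>M\<^esub> \<one>\<^bsub>M\<^esub>) \<otimes>\<^bsub>M\<^esub> eval_coeffs a f"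
    using Const a by (simp add: smult_assoc2 eval_coeffs_closed)
  finally show ?case by simp
next
  case (Var n)
  let ?S = "{m. f m \<noteq> \<zero>\<^bsub>R\<^esub>}"
  have "eval_coeffs a (R.act (Var n) f)
      = (\<Oplus>\<^bsub>M\<^esub>m\<in>add_mset n ` ?S. R.act (Var n) f m \<odot>\<^bsub>M\<^esub> eval_monom a m)"
    using Var a by (intro eval_coeffs_supset)
      (auto split: if_splits intro!: image_eqI[of _ _ "_ - {#n#}"])
  \<comment> \<open>Multiplication by a variable shifts the support, so the sum is reindexed along
    \<open>add_mset n\<close>.\<close>
  also have "\<dots> = (\<Oplus>\<^bsub>M\<^esub>m\<in>?S. R.act (Var n) f (add_mset n m) \<odot>\<^bsub>M\<^esub> eval_monom a (add_mset n m))"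
    using Var a by (intro M.finsum_reindex) (auto simp: eval_monom_closed inj_on_def)
  also have "\<dots> = (\<Oplus>\<^bsub>M\<^esub>m\<in>?S. a n \<otimes>\<^bsub>M\<^esub> (f m \<odot>\<^bsub>M\<^esub> eval_monom a m))"
    using Var a
    by (intro M.finsum_cong')
      (auto simp: eval_monom_add_mset eval_monom_closed smult_rcomm)
  also have "\<dots> = a n \<otimes>\<^bsub>M\<^esub> eval_coeffs a f"
    unfolding eval_coeffs_def using Var a
    by (subst finsum_rdistr) (auto simp: eval_monom_closed)
  finally show ?case by simp
next
  case (Plus s t)
  let ?S = "{m. R.act s f m \<noteq> \<zero>\<^bsub>R\<^esub>} \<union> {m. R.act t f m \<noteq> \<zero>\<^bsub>R\<^esub>}"
  have fin: "finite ?S" using Plus by (simp add: R.finite_supp_act)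
  have cl: "R.act s f m \<in> carrier R" "R.act t f m \<in> carrier R" for m
    using Plus by (auto simp: R.act_closed)
  have "eval_coeffs a (R.act (Plus s t) f)
      = (\<Oplus>\<^bsub>M\<^esub>m\<in>?S. R.act (Plus s t) f m \<odot>\<^bsub>M\<^esub> eval_monom a m)"
    using fin a cl by (intro eval_coeffs_supset) auto
  also have "\<dots> = (\<Oplus>\<^bsub>M\<^esub>m\<in>?S. R.act s f m \<odot>\<^bsub>M\<^esub> eval_monom a m \<oplus>\<^bsub>M\<^esub> R.act t f m \<odot>\<^bsub>M\<^esub> eval_monom a m)"
    using cl a by (intro M.finsum_cong') (auto simp: eval_monom_closed smult_l_distr)
  also have "\<dots> = (\<Oplus>\<^bsub>M\<^esub>m\<in>?S. R.act s f m \<odot>\<^bsub>M\<^esub> eval_monom a m)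
      \<oplus>\<^bsub>M\<^esub> (\<Oplus>\<^bsub>M\<^esub>m\<in>?S. R.act t f m \<odot>\<^bsub>M\<^esub> eval_monom a m)"
    using cl a by (intro M.finsum_addf) (auto simp: eval_monom_closed)
  also have "\<dots> = eval_coeffs a (R.act s f) \<oplus>\<^bsub>M\<^esub> eval_coeffs a (R.act t f)"
    using cl a fin by (subst (1 2) eval_coeffs_supset[of _ _ ?S]) auto
  finally show ?case
    using Plus a by (simp add: l_distr eval_coeffs_closed eval_expr_closed)
next
  case (Times s t)
  then show ?case
    using a by (simp add: R.act_closed R.finite_supp_act m_assoc eval_coeffs_closed eval_expr_closed)
qed

lemma eval_coeffs_poly_of:
  assumes a: "\<And>n. a n \<in> carrier M" and t: "expr_consts t \<subseteq> carrier R"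
  shows "eval_coeffs a (R.poly_of t) = eval_expr a t"
proof -
  let ?d = "\<lambda>m::nat multiset. if m = {#} then \<one>\<^bsub>R\<^esub> else \<zero>\<^bsub>R\<^esub>"
  have "eval_coeffs a ?d = (\<Oplus>\<^bsub>M\<^esub>m\<in>{{#}}. ?d m \<odot>\<^bsub>M\<^esub> eval_monom a m)"
  proof (rule eval_coeffs_supset)
    show "{m. ?d m \<noteq> \<zero>\<^bsub>R\<^esub>} \<subseteq> {{#}}" by auto
  qed (use a in simp_all)
  also have "\<dots> = \<one>\<^bsub>M\<^esub>"
    by (simp add: eval_monom_def)
  finally have "eval_coeffs a ?d = \<one>\<^bsub>M\<^esub>" .
  moreover have "eval_coeffs a (R.act t ?d) = eval_expr a t \<otimes>\<^bsub>M\<^esub> eval_coeffs a ?d"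
    using a t by (intro eval_coeffs_act) auto
  ultimately show ?thesis
    using a t by (simp add: R.poly_of_def eval_expr_closed)
qed

end

text \<open>Once elements are written as \<open>poly_of t\<close>, evaluation is
  \<open>eval_expr\<close>, which respects sums and products by definition.\<close>

lemma eval_coeffs_hom:
  fixes R :: "'r ring"
  assumes "algebra R A" and a: "\<And>n. a n \<in> carrier A"
  shows "algebra.eval_coeffs R A a \<in> alg_hom R (cring.poly_alg R) A"
proof -
  interpret algebra R A by fact
  show ?thesis
    unfolding alg_hom_def
    by (auto intro!: ring_hom_memI elim!: R.poly_alg_carrierE
        simp: R.poly_alg_ops eval_coeffs_poly_of a eval_expr_closed smult_assoc2)
qed

section \<open>Copying the polynomial algebra into the universe type\<close>

definition transport :: "('b \<Rightarrow> 'c) \<Rightarrow> ('r, 'b) module \<Rightarrow> ('r, 'c) module" where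
  "transport j B = (let k = inv_into (carrier B) j in
     \<lparr>carrier = j ` carrier B,
      monoid.mult = (\<lambda>x y. j (k x \<otimes>\<^bsub>B\<^esub> k y)),
      one = j \<one>\<^bsub>B\<^esub>,
      ring.zero = j \<zero>\<^bsub>B\<^esub>,
      add = (\<lambda>x y. j (k x \<oplus>\<^bsub>B\<^esub> k y)),
      module.smult = (\<lambda>r x. j (r \<odot>\<^bsub>B\<^esub> k x))\<rparr>)"

lemma transport_algebra:
  assumes "inj_on j (carrier M)" and "algebra R M"
  shows "algebra R (transport j M)"
proof -
  interpret algebra R M by fact
  note [simp] = transport_def Let_def inv_into_f_f[OF assms(1)]
  show ?thesis
  proof (rule algebraI)
    show "cring (transport j M)"
    proof (rule cringI)
      show "abelian_group (transport j M)"
      proof (rule abelian_groupI)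
        fix x assume "x \<in> carrier (transport j M)"
        then obtain b where b: "b \<in> carrier M" "x = j b" by auto
        have "j (\<ominus>\<^bsub>M\<^esub> b) \<oplus>\<^bsub>transport j M\<^esub> x = \<zero>\<^bsub>transport j M\<^esub>"
          using b by (simp add: M.l_neg)
        then show "\<exists>y\<in>carrier (transport j M). y \<oplus>\<^bsub>transport j M\<^esub> x = \<zero>\<^bsub>transport j M\<^esub>"
          by (rule bexI) (use b in simp)
      qed (auto simp: M.a_ac)
      show "comm_monoid (transport j M)"
        by (rule comm_monoidI) (auto simp: m_ac)
    qed (auto simp: l_distr)
  qed (use R_cring in \<open>auto simp: smult_l_distr smult_r_distr smult_assoc1 smult_assoc2\<close>)
qed

lemma transport_hom:
  assumes j: "inj_on j (carrier B)" and h: "h \<in> alg_hom R B A" and "algebra R B"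
  shows "h \<circ> inv_into (carrier B) j \<in> alg_hom R (transport j B) A"
proof -
  interpret algebra R B by fact
  show ?thesis
    using h unfolding alg_hom_def
    by (auto intro!: ring_hom_memI simp: transport_def Let_def inv_into_f_f[OF j]
        ring_hom_closed ring_hom_mult ring_hom_add ring_hom_one)
qed

text \<open>An infinite type is in bijection with its square, so a tree with leaves in C and in the
  natural numbers can be coded by nested pairs.\<close>

lemma expr_lepoll:
  fixes C :: "'r set"
  assumes C: "C \<lesssim> (UNIV :: 'u set)" and inf: "infinite (UNIV :: 'u set)"
  shows "{t. expr_consts t \<subseteq> C} \<lesssim> (UNIV :: 'u set)"
proof -
  obtain c :: "'r \<Rightarrow> 'u" where c: "inj_on c C"
    using C by (auto simp: lepoll_def)
  obtain v :: "nat \<Rightarrow> 'u" where v: "inj v"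
    using inf infinite_le_lepoll[of "UNIV :: 'u set"] by (auto simp: lepoll_def)
  obtain pr :: "'u \<times> 'u \<Rightarrow> 'u" where "bij_betw pr (UNIV \<times> UNIV) UNIV"
    using card_of_Times_same_infinite[OF inf] unfolding card_of_ordIso[symmetric] by blast
  then have pr: "pr x = pr y \<longleftrightarrow> x = y" for x y
    using inj_eq[of pr] by (simp add: bij_betw_def)
  \<comment> \<open>The distinct elements \<open>v 0\<close> to \<open>v 3\<close> tag the four
    constructors, so that codes of different constructors never coincide.\<close>
  define enc where "enc = rec_expr (\<lambda>r. pr (v 0, c r)) (\<lambda>n. pr (v 1, v n))
    (\<lambda>s t x y. pr (v 2, pr (x, y))) (\<lambda>s t x y. pr (v 3, pr (x, y)))"
  have enc_rec: "enc (Const r) = pr (v 0, c r)" "enc (Var n) = pr (v 1, v n)"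
      "enc (Plus s t) = pr (v 2, pr (enc s, enc t))" "enc (Times s t) = pr (v 3, pr (enc s, enc t))"
    for r n s t
    by (simp_all add: enc_def)
  note enc_simps = enc_rec pr inj_eq[OF v]
  have "s = t" if "expr_consts s \<subseteq> C" "expr_consts t \<subseteq> C" "enc s = enc t" for s t
    using that
  proof (induction s arbitrary: t)
    case (Const r)
    then show ?case
      by (cases t) (auto simp: enc_simps dest: inj_onD[OF c])
  next
    case (Var n)
    then show ?case by (cases t) (simp_all add: enc_simps)
  next
    case (Plus s1 s2)
    show ?case
      using Plus.prems by (cases t) (auto simp: enc_simps intro: Plus.IH)
  next
    case (Times s1 s2)
    show ?case
      using Times.prems by (cases t) (auto simp: enc_simps intro: Times.IH)
  qed
  then have "inj_on enc {t. expr_consts t \<subseteq> C}"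
    by (auto simp: inj_on_def)
  then show ?thesis by (auto simp: lepoll_def)
qed

text \<open>Cancellation of nonzero scalars is inherited coefficientwise from the domain R. Of
  freeness only the existence half is stated: what is wanted is some homomorphism with prescribed
  values on the generators.\<close>

lemma free_algebra_in_type:
  fixes R :: "'r ring" (structure)
  assumes "domain R" and "carrier R \<lesssim> (UNIV :: 'u set)" and "infinite (UNIV :: 'u set)"
  obtains B :: "('r, 'u) module" and gen :: "nat \<Rightarrow> 'u"
  where "algebra R B"
    and "\<And>r x y. \<lbrakk>r \<in> carrier R; r \<noteq> \<zero>\<^bsub>R\<^esub>; x \<in> carrier B; y \<in> carrier B; r \<odot>\<^bsub>B\<^esub> x = r \<odot>\<^bsub>B\<^esub> y\<rbrakk> \<Longrightarrow> x = y"
    and "\<And>n. gen n \<in> carrier B"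
    and "\<And>(A :: ('r, 'u) module) a. \<lbrakk>algebra R A; \<And>n. a n \<in> carrier A\<rbrakk>
           \<Longrightarrow> \<exists>h\<in>alg_hom R B A. \<forall>n. h (gen n) = a n"
proof -
  interpret domain R by fact
  have "carrier poly_alg \<lesssim> {t. expr_consts t \<subseteq> carrier R}"
    by (simp add: poly_alg_def image_lepoll)
  then have "carrier poly_alg \<lesssim> (UNIV :: 'u set)"
    using expr_lepoll[OF assms(2,3)] lepoll_trans by blast
  then obtain j :: "(nat multiset \<Rightarrow> 'r) \<Rightarrow> 'u" where j: "inj_on j (carrier poly_alg)"
    by (auto simp: lepoll_def)
  have X: "poly_of (Var n) \<in> carrier poly_alg" for n
    by (rule poly_of_in_carrier) simp
  show thesis
  proof (rule that)
    show "algebra R (transport j poly_alg)"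
      using j poly_alg_algebra by (rule transport_algebra)
    show "j (poly_of (Var n)) \<in> carrier (transport j poly_alg)" for n
      using X by (simp add: transport_def Let_def)
    fix r x y
    assume r: "r \<in> carrier R" "r \<noteq> \<zero>\<^bsub>R\<^esub>" and "x \<in> carrier (transport j poly_alg)"
      "y \<in> carrier (transport j poly_alg)"
      and eq: "r \<odot>\<^bsub>transport j poly_alg\<^esub> x = r \<odot>\<^bsub>transport j poly_alg\<^esub> y"
    then obtain p q where p: "p \<in> carrier poly_alg" "x = j p" and q: "q \<in> carrier poly_alg" "y = j q"
      by (auto simp: transport_def Let_def)
    have "j (r \<odot>\<^bsub>poly_alg\<^esub> p) = j (r \<odot>\<^bsub>poly_alg\<^esub> q)"
      using eq p q j by (simp add: transport_def Let_def inv_into_f_f)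
    then have "r \<odot>\<^bsub>poly_alg\<^esub> p = r \<odot>\<^bsub>poly_alg\<^esub> q"
      by (rule inj_onD[OF j]) (use p q r module.smult_closed[OF algebra.module[OF poly_alg_algebra]] in simp_all)
    then have "r \<otimes> p m = r \<otimes> q m" for m
      by (simp add: poly_alg_def fun_eq_iff)
    moreover have "p m \<in> carrier R" "q m \<in> carrier R" for m
      using p q by (auto elim!: poly_alg_carrierE simp: poly_of_closed)
    ultimately have "p = q"
      using r by (auto simp: m_lcancel)
    then show "x = y" using p q by simp
  next
    fix A :: "('r, 'u) module" and a :: "nat \<Rightarrow> 'u"
    assume A: "algebra R A" and a: "\<And>n. a n \<in> carrier A"
    interpret A: algebra R A by fact
    have "A.eval_coeffs a \<circ> inv_into (carrier poly_alg) j \<in> alg_hom R (transport j poly_alg) A"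
      using j eval_coeffs_hom[OF A a] poly_alg_algebra by (rule transport_hom)
    moreover have "A.eval_coeffs a (inv_into (carrier poly_alg) j (j (poly_of (Var n)))) = a n" for n
      using a by (simp add: inv_into_f_f[OF j X] A.eval_coeffs_poly_of)
    ultimately show "\<exists>h\<in>alg_hom R (transport j poly_alg) A. \<forall>n. h (j (poly_of (Var n))) = a n"
      by (intro bexI) auto
  qed
qed

section \<open>Witt vectors and restriction of scalars\<close>

lemma restrict_scalars_algebra:
  fixes S :: "'s ring" and R :: "'r ring"
  assumes "algebra R A" "cring S" "\<sigma> \<in> ring_hom S R"
  shows "algebra S (restrict_scalars \<sigma> A)"
proof -
  interpret algebra R A by fact
  show ?thesis
  proof (rule algebraI)
    show "cring (restrict_scalars \<sigma> A)"
    proof (rule cringI)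
      show "abelian_group (restrict_scalars \<sigma> A)"
      proof (rule abelian_groupI)
        fix x assume "x \<in> carrier (restrict_scalars \<sigma> A)"
        then show "\<exists>y\<in>carrier (restrict_scalars \<sigma> A).
            y \<oplus>\<^bsub>restrict_scalars \<sigma> A\<^esub> x = \<zero>\<^bsub>restrict_scalars \<sigma> A\<^esub>"
          by (intro bexI[of _ "\<ominus>\<^bsub>A\<^esub> x"]) (auto simp: restrict_scalars_def M.l_neg)
      qed (auto simp: restrict_scalars_def M.a_ac)
      show "comm_monoid (restrict_scalars \<sigma> A)"
        by (rule comm_monoidI) (auto simp: restrict_scalars_def m_ac)
    qed (auto simp: restrict_scalars_def l_distr)
  qed (use assms in \<open>auto simp: restrict_scalars_def ring_hom_closed ring_hom_add ring_hom_mult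
         ring_hom_one smult_l_distr smult_r_distr smult_assoc1 smult_assoc2\<close>)
qed

lemma restrict_scalars_hom:
  assumes "h \<in> alg_hom R A B" "\<sigma> \<in> ring_hom S R"
  shows "h \<in> alg_hom S (restrict_scalars \<sigma> A) (restrict_scalars \<sigma> B)"
  using assms by (auto simp: alg_hom_def restrict_scalars_def ring_hom_def)

text \<open>Restriction keeps the ring operations of A, and the k-th power of p acts as the k-th
  power of \<open>\<rho>\<close>; the two ghost maps are therefore the same function.\<close>

lemma ghost_restrict_scalars:
  assumes "\<And>k::nat. \<sigma> (p [^]\<^bsub>S\<^esub> k) = \<rho> [^]\<^bsub>R\<^esub> k"
  shows "ghost S p q (restrict_scalars \<sigma> A) = ghost R \<rho> q A"
  unfolding ghost_def
  by (simp add: restrict_scalars_def assms[unfolded nat_pow_def] fun_eq_iff finsum_def finprod_def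
      nat_pow_def)

text \<open>The equations are triangular: the n-th ghost component is \<open>\<rho>\<close>^n times
  the n-th entry plus terms in earlier entries. Strong induction removes those terms, and
  \<open>tf\<close> cancels the power.\<close>

lemma ghost_inject:
  assumes "algebra R B" and \<rho>: "\<rho> \<in> carrier R"
    and tf: "\<And>k x y. \<lbrakk>x \<in> carrier B; y \<in> carrier B; \<rho> [^]\<^bsub>R\<^esub> k \<odot>\<^bsub>B\<^esub> x = \<rho> [^]\<^bsub>R\<^esub> (k::nat) \<odot>\<^bsub>B\<^esub> y\<rbrakk> \<Longrightarrow> x = y"
    and x: "\<And>n. x n \<in> carrier B" and y: "\<And>n. y n \<in> carrier B"
    and eq: "\<And>j. ghost R \<rho> q B j x = ghost R \<rho> q B j y"
  shows "x = y"
proof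
  fix n
  interpret algebra R B by fact
  show "x n = y n"
  proof (induction n rule: less_induct)
    case (less n)
    let ?t = "\<lambda>z k. \<rho> [^]\<^bsub>R\<^esub> k \<odot>\<^bsub>B\<^esub> (z k [^]\<^bsub>B\<^esub> (q ^ (n - k)))"
    \<comment> \<open>The summand k = n has exponent q^0 = 1, so the last entry occurs
      linearly.\<close>
    have split: "ghost R \<rho> q B n z = \<rho> [^]\<^bsub>R\<^esub> n \<odot>\<^bsub>B\<^esub> z n \<oplus>\<^bsub>B\<^esub> (\<Oplus>\<^bsub>B\<^esub>k\<in>{..<n}. ?t z k)"
      if "\<And>k. z k \<in> carrier B" for z
    proof -
      have "{..n} = insert n {..<n}" by auto
      then show ?thesis
        using that \<rho> by (simp add: ghost_def M.finsum_insert nat_pow_closed)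
    qed
    have "(\<Oplus>\<^bsub>B\<^esub>k\<in>{..<n}. ?t x k) = (\<Oplus>\<^bsub>B\<^esub>k\<in>{..<n}. ?t y k)"
      using less y \<rho> by (intro M.finsum_cong') auto
    moreover have "(\<Oplus>\<^bsub>B\<^esub>k\<in>{..<n}. ?t y k) \<in> carrier B"
      using y \<rho> by (intro M.finsum_closed) auto
    ultimately have "\<rho> [^]\<^bsub>R\<^esub> n \<odot>\<^bsub>B\<^esub> x n = \<rho> [^]\<^bsub>R\<^esub> n \<odot>\<^bsub>B\<^esub> y n"
      using eq[of n] x y \<rho> by (simp add: split)
    then show ?case
      using tf x y by blast
  qed
qed

section \<open>Comparison of two Witt vector functors along a homomorphism of base rings\<close>

text \<open>This isolates the algebra from the local fields; \<open>\<sigma>\<close> stands for the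
  evaluation at i. The assumption \<open>power\<close> speaks of all powers because these can be
  compared directly in the pointwise product of families.\<close>

locale witt_base_change =
  fixes S :: "'s ring" and R :: "'r ring" and \<sigma> p \<rho> q
    and W :: "('s, 'u) module \<Rightarrow> ('s, nat \<Rightarrow> 'u) module"
    and W' :: "('r, 'u) module \<Rightarrow> ('r, nat \<Rightarrow> 'u) module"
  assumes S: "cring S" and R: "domain R"
    and \<sigma>: "\<sigma> \<in> ring_hom S R"
    and power: "\<And>k::nat. \<sigma> (p [^]\<^bsub>S\<^esub> k) = \<rho> [^]\<^bsub>R\<^esub> k"
    and \<rho>: "\<rho> \<in> carrier R" "\<rho> \<noteq> \<zero>\<^bsub>R\<^esub>"
    and W: "witt_functor S p q W" and W': "witt_functor R \<rho> q W'"
    and small: "carrier R \<lesssim> (UNIV :: 'u set)" "infinite (UNIV :: 'u set)"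
begin

abbreviation res :: "('r, 'u) module \<Rightarrow> ('s, 'u) module" where
  "res \<equiv> restrict_scalars \<sigma>"

lemma carrier_W: "algebra R A \<Longrightarrow> carrier (W (res A)) = {a. \<forall>n. a n \<in> carrier A}"
  using W restrict_scalars_algebra[OF _ S \<sigma>, of A] by (simp add: witt_functor_def restrict_scalars_def)

lemma carrier_W': "algebra R A \<Longrightarrow> carrier (W' A) = {a. \<forall>n. a n \<in> carrier A}"
  using W' by (simp add: witt_functor_def)

lemma ghost_W: "algebra R A \<Longrightarrow> ghost R \<rho> q A j \<in> alg_hom S (W (res A)) (res A)"
  using W restrict_scalars_algebra[OF _ S \<sigma>, of A]
  unfolding witt_functor_def ghost_restrict_scalars[where \<sigma> = \<sigma>, OF power, symmetric] by blast

lemma ghost_W': "algebra R A \<Longrightarrow> ghost R \<rho> q A j \<in> alg_hom R (W' A) A"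
  using W' by (simp add: witt_functor_def)

lemma algebra_W: "algebra R A \<Longrightarrow> algebra S (W (res A))"
  using W restrict_scalars_algebra[OF _ S \<sigma>, of A] by (simp add: witt_functor_def)

lemma algebra_W': "algebra R A \<Longrightarrow> algebra R (W' A)"
  using W' by (simp add: witt_functor_def)

text \<open>Agreement is stated for a single pair, since this is the form that passes along a
  homomorphism whose image contains x and y. Scalars are tested on x only, which loses nothing once
  the pair is arbitrary.\<close>

definition same_ops :: "('r, 'u) module \<Rightarrow> (nat \<Rightarrow> 'u) \<Rightarrow> (nat \<Rightarrow> 'u) \<Rightarrow> bool" where
  "same_ops A x y \<longleftrightarrow>
     x \<otimes>\<^bsub>W (res A)\<^esub> y = x \<otimes>\<^bsub>W' A\<^esub> y \<and>
     x \<oplus>\<^bsub>W (res A)\<^esub> y = x \<oplus>\<^bsub>W' A\<^esub> y \<and>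
     \<one>\<^bsub>W (res A)\<^esub> = \<one>\<^bsub>W' A\<^esub> \<and>
     (\<forall>r\<in>carrier S. r \<odot>\<^bsub>W (res A)\<^esub> x = \<sigma> r \<odot>\<^bsub>W' A\<^esub> x)"

lemma same_ops_torsion_free:
  assumes B: "algebra R B"
    and tf: "\<And>r x y. \<lbrakk>r \<in> carrier R; r \<noteq> \<zero>\<^bsub>R\<^esub>; x \<in> carrier B; y \<in> carrier B; r \<odot>\<^bsub>B\<^esub> x = r \<odot>\<^bsub>B\<^esub> y\<rbrakk> \<Longrightarrow> x = y"
    and x: "\<And>n. x n \<in> carrier B" and y: "\<And>n. y n \<in> carrier B"
  shows "same_ops B x y"
proof -
  interpret R: domain R by (rule R)
  interpret V: algebra S "W (res B)" using B by (rule algebra_W)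
  interpret V': algebra R "W' B" using B by (rule algebra_W')
  have \<rho>_pow: "\<rho> [^]\<^bsub>R\<^esub> (k::nat) \<noteq> \<zero>\<^bsub>R\<^esub>" for k
    using \<rho> by (induction k) (auto simp: R.integral_iff)
  \<comment> \<open>The elements a and b belong to different algebras, but both carriers consist of
    all sequences in B, so ghost components can be compared across them.\<close>
  have eqI: "a = b" if "a \<in> carrier (W (res B))" "b \<in> carrier (W' B)"
    "\<And>j. ghost R \<rho> q B j a = ghost R \<rho> q B j b" for a b
    using that carrier_W[OF B] carrier_W'[OF B] \<rho> \<rho>_pow
    by (intro ghost_inject[OF B, of \<rho> a b q]) (auto intro: tf[of "\<rho> [^]\<^bsub>R\<^esub> k" for k])
  have xy: "x \<in> carrier (W (res B))" "y \<in> carrier (W (res B))" "x \<in> carrier (W' B)" "y \<in> carrier (W' B)"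
    using x y carrier_W[OF B] carrier_W'[OF B] by auto
  note G = ghost_W[OF B, unfolded alg_hom_def, simplified, THEN conjunct1]
    ghost_W[OF B, unfolded alg_hom_def, simplified, THEN conjunct2, rule_format]
  note G' = ghost_W'[OF B, unfolded alg_hom_def, simplified, THEN conjunct1]
    ghost_W'[OF B, unfolded alg_hom_def, simplified, THEN conjunct2, rule_format]
  have res: "x \<otimes>\<^bsub>res B\<^esub> y = x \<otimes>\<^bsub>B\<^esub> y" "x \<oplus>\<^bsub>res B\<^esub> y = x \<oplus>\<^bsub>B\<^esub> y" "\<one>\<^bsub>res B\<^esub> = \<one>\<^bsub>B\<^esub>"
    "r \<odot>\<^bsub>res B\<^esub> x = \<sigma> r \<odot>\<^bsub>B\<^esub> x" for x y r
    by (simp_all add: restrict_scalars_def)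
  show ?thesis
    unfolding same_ops_def
  proof (intro conjI ballI)
    show "x \<otimes>\<^bsub>W (res B)\<^esub> y = x \<otimes>\<^bsub>W' B\<^esub> y"
      using xy ring_hom_mult[OF G(1)] ring_hom_mult[OF G'(1)] by (intro eqI) (simp_all add: res)
    show "x \<oplus>\<^bsub>W (res B)\<^esub> y = x \<oplus>\<^bsub>W' B\<^esub> y"
      using xy ring_hom_add[OF G(1)] ring_hom_add[OF G'(1)] by (intro eqI) (simp_all add: res)
    show "\<one>\<^bsub>W (res B)\<^esub> = \<one>\<^bsub>W' B\<^esub>"
      using ring_hom_one[OF G(1)] ring_hom_one[OF G'(1)] by (intro eqI) (simp_all add: res)
    fix r assume r: "r \<in> carrier S"
    then show "r \<odot>\<^bsub>W (res B)\<^esub> x = \<sigma> r \<odot>\<^bsub>W' B\<^esub> x"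
      using xy G(2) G'(2) ring_hom_closed[OF \<sigma>] by (intro eqI) (simp_all add: res)
  qed
qed

text \<open>Both functors send h to the same map, application of h to every entry, so one function
  carries both structures on B to those on A.\<close>

lemma same_ops_hom:
  assumes B: "algebra R B" and A: "algebra R A" and h: "h \<in> alg_hom R B A"
    and x: "\<And>n. x n \<in> carrier B" and y: "\<And>n. y n \<in> carrier B" and same: "same_ops B x y"
  shows "same_ops A (\<lambda>n. h (x n)) (\<lambda>n. h (y n))"
proof -
  let ?h = "\<lambda>a n. h (a n)"
  have "?h \<in> alg_hom S (W (res B)) (W (res A))"
    using W restrict_scalars_algebra[OF A S \<sigma>] restrict_scalars_algebra[OF B S \<sigma>]
      restrict_scalars_hom[OF h \<sigma>]
    unfolding witt_functor_def by blast
  then have H: "?h \<in> ring_hom (W (res B)) (W (res A))"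
    and Hs: "\<And>r a. \<lbrakk>r \<in> carrier S; a \<in> carrier (W (res B))\<rbrakk> \<Longrightarrow> ?h (r \<odot>\<^bsub>W (res B)\<^esub> a) = r \<odot>\<^bsub>W (res A)\<^esub> ?h a"
    by (auto simp: alg_hom_def)
  have "?h \<in> alg_hom R (W' B) (W' A)"
    using W' A B h unfolding witt_functor_def by blast
  then have H': "?h \<in> ring_hom (W' B) (W' A)"
    and Hs': "\<And>r a. \<lbrakk>r \<in> carrier R; a \<in> carrier (W' B)\<rbrakk> \<Longrightarrow> ?h (r \<odot>\<^bsub>W' B\<^esub> a) = r \<odot>\<^bsub>W' A\<^esub> ?h a"
    by (auto simp: alg_hom_def)
  have xy: "x \<in> carrier (W (res B))" "y \<in> carrier (W (res B))" "x \<in> carrier (W' B)" "y \<in> carrier (W' B)"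
    using x y carrier_W[OF B] carrier_W'[OF B] by auto
  show ?thesis
    using same xy unfolding same_ops_def
    by (simp add: ring_hom_mult[OF H, symmetric] ring_hom_mult[OF H', symmetric]
        ring_hom_add[OF H, symmetric] ring_hom_add[OF H', symmetric]
        ring_hom_one[OF H, symmetric] ring_hom_one[OF H', symmetric]
        Hs[symmetric] Hs'[symmetric] ring_hom_closed[OF \<sigma>])
qed

lemma same_ops:
  assumes A: "algebra R A" and x: "\<And>n. x n \<in> carrier A" and y: "\<And>n. y n \<in> carrier A"
  shows "same_ops A x y"
proof (rule free_algebra_in_type[OF R small])
  fix B :: "('r, 'u) module" and gen :: "nat \<Rightarrow> 'u"
  assume B: "algebra R B"
    and tf: "\<And>r x y. \<lbrakk>r \<in> carrier R; r \<noteq> \<zero>\<^bsub>R\<^esub>; x \<in> carrier B; y \<in> carrier B; r \<odot>\<^bsub>B\<^esub> x = r \<odot>\<^bsub>B\<^esub> y\<rbrakk> \<Longrightarrow> x = y"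
    and gen: "\<And>n. gen n \<in> carrier B"
    and free: "\<And>(A :: ('r, 'u) module) a. \<lbrakk>algebra R A; \<And>n. a n \<in> carrier A\<rbrakk>
      \<Longrightarrow> \<exists>h\<in>alg_hom R B A. \<forall>n. h (gen n) = a n"
  \<comment> \<open>Interleaving x and y over even and odd generators lets a single homomorphism
    reach both sequences.\<close>
  have "\<exists>h\<in>alg_hom R B A. \<forall>n. h (gen n) = (if even n then x (n div 2) else y (n div 2))"
    by (rule free[OF A]) (simp add: x y)
  then obtain h where h: "h \<in> alg_hom R B A"
    and "\<forall>n. h (gen n) = (if even n then x (n div 2) else y (n div 2))"
    by blast
  then have "x = (\<lambda>n. h (gen (2 * n)))" "y = (\<lambda>n. h (gen (2 * n + 1)))"
    by auto
  moreover have "same_ops B (\<lambda>n. gen (2 * n)) (\<lambda>n. gen (2 * n + 1))"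
    by (rule same_ops_torsion_free[OF B tf gen gen])
  ultimately show ?thesis
    using same_ops_hom[OF B A h gen gen] by metis
qed

lemma id_alg_iso:
  assumes A: "algebra R A"
  shows "(\<lambda>a. a) \<in> alg_iso S (W (res A)) (restrict_scalars \<sigma> (W' A))"
proof -
  have "same_ops A a b" if "a \<in> carrier (W' A)" "b \<in> carrier (W' A)" for a b
    using that carrier_W'[OF A] by (intro same_ops[OF A]) auto
  \<comment> \<open>Equality of the units is part of \<open>same_ops A a b\<close>, so some element
    of the carrier is needed to extract it.\<close>
  moreover have "\<one>\<^bsub>W' A\<^esub> \<in> carrier (W' A)"
    using algebra_W'[OF A] by (meson algebra.M_cring cring.axioms(1) monoid.one_closed ring.axioms(2))
  ultimately show ?thesis
    using carrier_W[OF A] carrier_W'[OF A]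
    by (auto simp: alg_iso_def alg_hom_def restrict_scalars_def same_ops_def bij_betw_def
        intro!: ring_hom_memI)
qed

end

section \<open>The ring of families\<close>

context nonarch_local_field
begin

lemma val_one: "v \<one> = 0"
  using val_mult[of \<one> \<one>] by simp

text \<open>From (-1)^2 = 1 follows 2 v(-1) = 0, hence v(-1) = 0 in the integers.\<close>

lemma val_minus:
  assumes "x \<in> carrier L - {\<zero>}"
  shows "v (\<ominus> x) = v x"
proof -
  have "\<ominus> \<one> \<in> carrier L - {\<zero>}"
    by (metis Diff_iff a_inv_closed add.inv_eq_1_iff insertE one_closed one_not_zero singletonD)
  moreover have "\<ominus> \<one> \<otimes> \<ominus> \<one> = \<one>"
    by (simp add: l_minus)
  ultimately have "v (\<ominus> \<one>) = 0"
    using val_mult[of "\<ominus> \<one>" "\<ominus> \<one>"] val_one by simp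
  moreover have "\<ominus> x = \<ominus> \<one> \<otimes> x"
    using assms by (simp add: l_minus)
  ultimately show ?thesis
    using val_mult[of "\<ominus> \<one>" x] assms \<open>\<ominus> \<one> \<in> carrier L - {\<zero>}\<close> by simp
qed

lemma val_pow:
  assumes "x \<in> carrier L - {\<zero>}"
  shows "x [^] (n::nat) \<in> carrier L - {\<zero>}" "v (x [^] n) = int n * v x"
proof -
  have "x [^] n \<in> carrier L - {\<zero>} \<and> v (x [^] n) = int n * v x"
  proof (induction n)
    case (Suc n)
    then show ?case
      using assms val_mult[of "x [^] n" x] by (auto simp: integral_iff algebra_simps)
  qed (simp add: val_one)
  then show "x [^] (n::nat) \<in> carrier L - {\<zero>}" "v (x [^] n) = int n * v x" by auto
qed

text \<open>The value of v at zero is arbitrary, so zero arguments and vanishing sums are split off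
  before the valuation axioms apply.\<close>

lemma val_ring_subring: "subring {x \<in> carrier L. x = \<zero> \<or> 0 \<le> v x} L"
proof (rule subringI)
  fix x y assume *: "x \<in> {x \<in> carrier L. x = \<zero> \<or> 0 \<le> v x}" "y \<in> {x \<in> carrier L. x = \<zero> \<or> 0 \<le> v x}"
  show "x \<otimes> y \<in> {x \<in> carrier L. x = \<zero> \<or> 0 \<le> v x}"
    using * val_mult[of x y] by (cases "x = \<zero> \<or> y = \<zero>") auto
  show "x \<oplus> y \<in> {x \<in> carrier L. x = \<zero> \<or> 0 \<le> v x}"
    using * val_add[of x y] by (cases "x = \<zero> \<or> y = \<zero> \<or> x \<oplus> y = \<zero>") auto
next
  fix x assume *: "x \<in> {x \<in> carrier L. x = \<zero> \<or> 0 \<le> v x}"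
  show "\<ominus> x \<in> {x \<in> carrier L. x = \<zero> \<or> 0 \<le> v x}"
    using * val_minus[of x] by (cases "x = \<zero>") auto
qed (auto simp: val_one)

lemma val_ring_domain: "domain (val_ring L v)"
  using subring_is_domain[OF val_ring_subring] by (simp add: val_ring_def)

lemma val_ideal_ideal: "ideal (val_ideal L v) (val_ring L v)"
proof -
  interpret S: domain "val_ring L v" by (rule val_ring_domain)
  \<comment> \<open>Negation is not a field of the ring record but is defined through the carrier,
    so it has to be identified with that of L before \<open>val_minus\<close> applies.\<close>
  have inv: "\<ominus>\<^bsub>val_ring L v\<^esub> x = \<ominus> x" if "x \<in> carrier (val_ring L v)" for x
  proof (rule S.minus_equality)
    have "\<ominus> x \<in> carrier (val_ring L v)"
      using that val_minus[of x] by (cases "x = \<zero>") (auto simp: val_ring_def)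
    then show "\<ominus> x \<in> carrier (val_ring L v)" .
    show "\<ominus> x \<oplus>\<^bsub>val_ring L v\<^esub> x = \<zero>\<^bsub>val_ring L v\<^esub>"
      using that by (simp add: val_ring_def l_neg)
  qed (use that in simp)
  have sub: "val_ideal L v \<subseteq> carrier (val_ring L v)"
    by (auto simp: val_ideal_def val_ring_def)
  show ?thesis
  proof (rule idealI)
    show "ring (val_ring L v)" by (rule S.ring_axioms)
    show "subgroup (val_ideal L v) (add_monoid (val_ring L v))"
    proof (rule S.add.subgroupI)
      show "val_ideal L v \<subseteq> carrier (val_ring L v)" by (rule sub)
      show "val_ideal L v \<noteq> {}" by (auto simp: val_ideal_def)
      show "\<ominus>\<^bsub>val_ring L v\<^esub> x \<in> val_ideal L v" if "x \<in> val_ideal L v" for x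
        using that subsetD[OF sub that] inv[of x] val_minus[of x]
        by (cases "x = \<zero>") (auto simp: val_ideal_def)
      show "x \<oplus>\<^bsub>val_ring L v\<^esub> y \<in> val_ideal L v"
        if "x \<in> val_ideal L v" "y \<in> val_ideal L v" for x y
        using that val_add[of x y]
        by (cases "x = \<zero> \<or> y = \<zero> \<or> x \<oplus> y = \<zero>") (auto simp: val_ideal_def val_ring_def)
    qed
    show *: "x \<otimes>\<^bsub>val_ring L v\<^esub> a \<in> val_ideal L v"
      if "a \<in> val_ideal L v" "x \<in> carrier (val_ring L v)" for a x
      using that val_mult[of x a]
      by (cases "x = \<zero> \<or> a = \<zero>") (auto simp: val_ideal_def val_ring_def)
    show "a \<otimes>\<^bsub>val_ring L v\<^esub> x \<in> val_ideal L v"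
      if "a \<in> val_ideal L v" "x \<in> carrier (val_ring L v)" for a x
      using *[OF that] that sub by (simp add: S.m_comm subset_iff)
  qed
qed

text \<open>The powers of a uniformizer have distinct valuations 0, 1, 2, and so on. This makes
  \<open>'u\<close> infinite, as the coding of expressions by pairs requires.\<close>

lemma val_ring_infinite: "infinite (carrier (val_ring L v))"
proof -
  obtain x where x: "x \<in> carrier L - {\<zero>}" "v x = 1"
    using val_normalized by auto
  have "inj (\<lambda>n::nat. x [^] n)"
    by (rule injI) (metis x val_pow(2) mult.right_neutral of_nat_eq_iff)
  moreover have "range (\<lambda>n::nat. x [^] n) \<subseteq> carrier (val_ring L v)"
    using val_pow[OF x(1)] x(2) by (auto simp: val_ring_def)
  ultimately show ?thesis
    using finite_subset range_inj_infinite by blast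
qed

end

section \<open>Powers of ideals and projections between quotients\<close>

lemma (in cring) ideal_power_ideal:
  assumes "ideal P R"
  shows "ideal (P [^]\<^bsub>ideals_set R\<^esub> (n::nat)) R"
  using monoid.nat_pow_closed[OF comm_monoid.axioms(1)[OF ideals_set_is_comm_monoid], of P n] assms
  by (simp add: ideals_set_def)

lemma (in cring) ideal_power_antimono:
  assumes P: "ideal P R" and "m \<le> n"
  shows "P [^]\<^bsub>ideals_set R\<^esub> (n::nat) \<subseteq> P [^]\<^bsub>ideals_set R\<^esub> m"
  using \<open>m \<le> n\<close>
proof (induction n rule: dec_induct)
  case (step n)
  have "P [^]\<^bsub>ideals_set R\<^esub> Suc n = ideal_prod R (P [^]\<^bsub>ideals_set R\<^esub> n) P"
    using monoid.nat_pow_Suc[OF comm_monoid.axioms(1)[OF ideals_set_is_comm_monoid]]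
    by (simp add: ideals_set_def)
  also have "\<dots> \<subseteq> P [^]\<^bsub>ideals_set R\<^esub> n"
    using ideal_prod_inter[OF ideal_power_ideal[OF P] P] by auto
  finally show ?case using step by auto
qed simp

text \<open>J absorbs I. The map C to \<open>J <+> C\<close> is the projection R/I to R/J, in the
  form used by \<open>transfer_image\<close>.\<close>

lemma (in ring) set_add_rcos:
  assumes I: "ideal I R" and J: "ideal J R" and "I \<subseteq> J" and x: "x \<in> carrier R"
  shows "J <+> (I +> x) = J +> x"
proof -
  interpret I: ideal I R by fact
  interpret J: ideal J R by fact
  have "J <+> I = J"
  proof
    show "J <+> I \<subseteq> J"
      using \<open>I \<subseteq> J\<close> by (auto simp: set_add_def')
    show "J \<subseteq> J <+> I"
    proof
      fix y assume "y \<in> J"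
      then have "y = y \<oplus> \<zero>" using J.Icarr by simp
      then show "y \<in> J <+> I"
        using \<open>y \<in> J\<close> I.zero_closed unfolding set_add_def' by blast
    qed
  qed
  then show ?thesis
    using a_setmult_rcos_assoc[of J I x] I.a_subset J.a_subset x by simp
qed

lemma (in ring) quotient_projection_hom:
  assumes I: "ideal I R" and J: "ideal J R" and "I \<subseteq> J"
  shows "(\<lambda>C. J <+> C) \<in> ring_hom (R Quot I) (R Quot J)"
proof -
  interpret I: ideal I R by fact
  interpret J: ideal J R by fact
  note [simp] = set_add_rcos[OF assms]
  have carr: "\<exists>x\<in>carrier R. C = I +> x" if "C \<in> carrier (R Quot I)" for C
    using that by (auto simp: FactRing_def A_RCOSETS_def')
  note hI = ring_hom_closed[OF I.rcos_ring_hom] ring_hom_mult[OF I.rcos_ring_hom, symmetric]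
    ring_hom_add[OF I.rcos_ring_hom, symmetric] ring_hom_one[OF I.rcos_ring_hom, symmetric]
  note hJ = ring_hom_closed[OF J.rcos_ring_hom] ring_hom_mult[OF J.rcos_ring_hom, symmetric]
    ring_hom_add[OF J.rcos_ring_hom, symmetric] ring_hom_one[OF J.rcos_ring_hom, symmetric]
  show ?thesis
    by (rule ring_hom_memI) (auto dest!: carr simp: hI hJ)
qed

section \<open>Ring structure on families and surjectivity of evaluation\<close>

context close_local_fields
begin

abbreviation \<O>' :: "enat \<Rightarrow> 'a ring" where
  "\<O>' j \<equiv> val_ring (E j) (v j)"

abbreviation pow_ideal :: "enat \<Rightarrow> nat \<Rightarrow> 'a set" where
  "pow_ideal j n \<equiv> ideal_power (\<O>' j) (val_ideal (E j) (v j)) n"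

abbreviation fam :: "(enat \<Rightarrow> 'a) ring" where
  "fam \<equiv> family_ring E v e \<phi>"

lemma domain_O: "domain (\<O>' j)"
  by (rule nonarch_local_field.val_ring_domain[OF local_field])

lemma ideal_pow: "ideal (pow_ideal j n) (\<O>' j)"
  by (intro cring.ideal_power_ideal domain.axioms(1) domain_O
      nonarch_local_field.val_ideal_ideal local_field)

lemma cring_O: "cring (\<O>' j)" and ring_O: "ring (\<O>' j)"
  using domain_O by (auto simp: domain_def cring_def)

abbreviation reduce :: "nat \<Rightarrow> 'a \<Rightarrow> 'a set" where
  "reduce n x \<equiv> pow_ideal \<infinity> n +>\<^bsub>\<O>' \<infinity>\<^esub> x"

abbreviation transfer :: "nat \<Rightarrow> nat \<Rightarrow> 'a \<Rightarrow> 'a set" where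
  "transfer \<equiv> transfer_image E v e \<phi>"

abbreviation quot :: "nat \<Rightarrow> 'a set ring" where
  "quot n \<equiv> \<O>' \<infinity> Quot pow_ideal \<infinity> n"

lemma reduce_hom: "reduce n \<in> ring_hom (\<O>' \<infinity>) (quot n)"
  by (rule ideal.rcos_ring_hom[OF ideal_pow])

lemma ring_quot: "ring (quot n)"
  by (rule ideal.quotient_is_ring[OF ideal_pow])

lemma pow_ideal_antimono: "m \<le> n \<Longrightarrow> pow_ideal j n \<subseteq> pow_ideal j m"
  by (intro cring.ideal_power_antimono cring_O nonarch_local_field.val_ideal_ideal local_field)

lemma \<phi>_iso: "\<phi> i \<in> ring_iso (\<O>' (enat i) Quot pow_ideal (enat i) (e i)) (quot (e i))"
  using deligne by (simp add: deligne_iso_def)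

text \<open>A composite of three homomorphisms; the last, a projection between quotients at
  infinity, exists because n \<le> \<open>e i\<close> makes the ideal for \<open>e i\<close> smaller
  than the one for n.\<close>

lemma transfer_hom:
  assumes "n \<le> e i"
  shows "transfer i n \<in> ring_hom (\<O>' (enat i)) (quot n)"
proof -
  have "(\<lambda>C. pow_ideal \<infinity> n <+>\<^bsub>\<O>' \<infinity>\<^esub> C) \<circ> (\<phi> i \<circ> (+>\<^bsub>\<O>' (enat i)\<^esub>) (pow_ideal (enat i) (e i)))
      \<in> ring_hom (\<O>' (enat i)) (quot n)"
  proof (intro ring_hom_trans)
    show "(+>\<^bsub>\<O>' (enat i)\<^esub>) (pow_ideal (enat i) (e i))
        \<in> ring_hom (\<O>' (enat i)) (\<O>' (enat i) Quot pow_ideal (enat i) (e i))"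
      by (rule ideal.rcos_ring_hom[OF ideal_pow])
    show "\<phi> i \<in> ring_hom (\<O>' (enat i) Quot pow_ideal (enat i) (e i)) (quot (e i))"
      using \<phi>_iso[of i] by (simp add: ring_iso_def)
    show "(\<lambda>C. pow_ideal \<infinity> n <+>\<^bsub>\<O>' \<infinity>\<^esub> C) \<in> ring_hom (quot (e i)) (quot n)"
      by (rule ring.quotient_projection_hom[OF ring_O ideal_pow ideal_pow pow_ideal_antimono[OF assms]])
  qed
  then show ?thesis
    by (simp add: transfer_image_def[abs_def] comp_def)
qed

text \<open>The lift is made at the finest level \<open>e i\<close>, where \<open>\<phi> i\<close>
  is onto. Coarser levels follow by projection, so one x serves all n at once.\<close>

lemma transfer_surj:
  assumes y: "y \<in> carrier (\<O>' \<infinity>)"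
  obtains x where "x \<in> carrier (\<O>' (enat i))" "\<And>n. n \<le> e i \<Longrightarrow> transfer i n x = reduce n y"
proof -
  have "reduce (e i) y \<in> carrier (quot (e i))"
    using reduce_hom y by (rule ring_hom_closed)
  then have "reduce (e i) y \<in> \<phi> i ` carrier (\<O>' (enat i) Quot pow_ideal (enat i) (e i))"
    using \<phi>_iso[of i] by (auto simp: ring_iso_def bij_betw_def)
  then obtain x where x: "x \<in> carrier (\<O>' (enat i))"
    "\<phi> i (pow_ideal (enat i) (e i) +>\<^bsub>\<O>' (enat i)\<^esub> x) = reduce (e i) y"
    by (auto simp: FactRing_def A_RCOSETS_def')
  have "transfer i n x = reduce n y" if "n \<le> e i" for n
    using x y ring.set_add_rcos[OF ring_O ideal_pow ideal_pow pow_ideal_antimono[OF that]]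
    by (simp add: transfer_image_def)
  then show thesis using that x by blast
qed

lemma eventually_le_e: "\<exists>N. \<forall>i\<ge>N. n \<le> e i"
  using ramification_tendsto by (simp add: filterlim_at_top eventually_sequentially)

lemma fam_carrier_iff:
  "f \<in> carrier fam \<longleftrightarrow>
     (\<forall>j. f j \<in> carrier (\<O>' j)) \<and>
     (\<forall>n\<ge>1. eventually (\<lambda>i. n \<le> e i \<and> transfer i n (f (enat i)) = reduce n (f \<infinity>)) sequentially)"
  by (simp add: family_ring_def eventually_sequentially)

text \<open>The bound n \<le> \<open>e i\<close> in the membership condition holds eventually
  because the ramification indices tend to infinity.\<close>

lemma fam_carrierI:
  assumes "\<And>j. f j \<in> carrier (\<O>' j)"
    and "\<And>n. eventually (\<lambda>i. n \<le> e i \<longrightarrow> transfer i n (f (enat i)) = reduce n (f \<infinity>)) sequentially"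
  shows "f \<in> carrier fam"
  unfolding fam_carrier_iff
proof (intro conjI allI impI)
  fix n :: nat
  have "eventually (\<lambda>i. n \<le> e i) sequentially"
    using eventually_le_e by (simp add: eventually_sequentially)
  then show "eventually (\<lambda>i. n \<le> e i \<and> transfer i n (f (enat i)) = reduce n (f \<infinity>)) sequentially"
    using assms(2)[of n] by eventually_elim auto
qed (rule assms(1))

lemma fam_closed_unary:
  assumes f: "f \<in> carrier fam"
    and cl: "\<And>j x. x \<in> carrier (\<O>' j) \<Longrightarrow> h j x \<in> carrier (\<O>' j)"
    and "\<And>i n x y. \<lbrakk>n \<le> e i; x \<in> carrier (\<O>' (enat i)); y \<in> carrier (\<O>' \<infinity>); transfer i n x = reduce n y\<rbrakk>
      \<Longrightarrow> transfer i n (h (enat i) x) = reduce n (h \<infinity> y)"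
  shows "(\<lambda>j. h j (f j)) \<in> carrier fam"
  unfolding fam_carrier_iff
proof (intro conjI allI impI)
  fix n :: nat assume "1 \<le> n"
  with f have "eventually (\<lambda>i. n \<le> e i \<and> transfer i n (f (enat i)) = reduce n (f \<infinity>)) sequentially"
    by (simp add: fam_carrier_iff)
  then show "eventually (\<lambda>i. n \<le> e i \<and>
      transfer i n (h (enat i) (f (enat i))) = reduce n (h \<infinity> (f \<infinity>))) sequentially"
    by (rule eventually_mono) (use f in \<open>simp add: fam_carrier_iff assms(3)\<close>)
qed (use f cl in \<open>simp add: fam_carrier_iff\<close>)

text \<open>Beyond the larger of the thresholds for f and g both congruences at level n hold, and
  the operation has only to preserve them.\<close>

lemma fam_closed_binary:
  assumes f: "f \<in> carrier fam" and g: "g \<in> carrier fam"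
    and cl: "\<And>j x y. \<lbrakk>x \<in> carrier (\<O>' j); y \<in> carrier (\<O>' j)\<rbrakk> \<Longrightarrow> h j x y \<in> carrier (\<O>' j)"
    and hom: "\<And>i n x y x' y'. \<lbrakk>n \<le> e i; x \<in> carrier (\<O>' (enat i)); y \<in> carrier (\<O>' (enat i));
      x' \<in> carrier (\<O>' \<infinity>); y' \<in> carrier (\<O>' \<infinity>); transfer i n x = reduce n x'; transfer i n y = reduce n y'\<rbrakk>
      \<Longrightarrow> transfer i n (h (enat i) x y) = reduce n (h \<infinity> x' y')"
  shows "(\<lambda>j. h j (f j) (g j)) \<in> carrier fam"
  unfolding fam_carrier_iff
proof (intro conjI allI impI)
  fix n :: nat assume n: "1 \<le> n"
  have "eventually (\<lambda>i. n \<le> e i \<and> transfer i n (f (enat i)) = reduce n (f \<infinity>)) sequentially"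
    "eventually (\<lambda>i. n \<le> e i \<and> transfer i n (g (enat i)) = reduce n (g \<infinity>)) sequentially"
    using f g n by (simp_all add: fam_carrier_iff)
  then show "eventually (\<lambda>i. n \<le> e i \<and>
      transfer i n (h (enat i) (f (enat i)) (g (enat i))) = reduce n (h \<infinity> (f \<infinity>) (g \<infinity>))) sequentially"
    by eventually_elim (use f g in \<open>simp add: fam_carrier_iff hom\<close>)
qed (use f g cl in \<open>simp add: fam_carrier_iff\<close>)

text \<open>The laws hold in each coordinate; the content is closure of the carrier, including
  closure under negation for additive inverses.\<close>

lemma cring_fam: "cring fam"
proof -
  interpret D: domain "\<O>' j" for j by (rule domain_O)
  have ops: "f \<otimes>\<^bsub>fam\<^esub> g = (\<lambda>j. f j \<otimes>\<^bsub>\<O>' j\<^esub> g j)" "f \<oplus>\<^bsub>fam\<^esub> g = (\<lambda>j. f j \<oplus>\<^bsub>\<O>' j\<^esub> g j)"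
    "\<one>\<^bsub>fam\<^esub> = (\<lambda>j. \<one>\<^bsub>\<O>' j\<^esub>)" "\<zero>\<^bsub>fam\<^esub> = (\<lambda>j. \<zero>\<^bsub>\<O>' j\<^esub>)" for f g
    by (simp_all add: family_ring_def)
  have cl: "f j \<in> carrier (\<O>' j)" if "f \<in> carrier fam" for f j
    using that by (simp add: fam_carrier_iff)
  have mult: "(\<lambda>j. f j \<otimes>\<^bsub>\<O>' j\<^esub> g j) \<in> carrier fam" if "f \<in> carrier fam" "g \<in> carrier fam" for f g
    using that by (rule fam_closed_binary) (simp_all add: ring_hom_mult[OF transfer_hom] ring_hom_mult[OF reduce_hom])
  have add: "(\<lambda>j. f j \<oplus>\<^bsub>\<O>' j\<^esub> g j) \<in> carrier fam" if "f \<in> carrier fam" "g \<in> carrier fam" for f g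
    using that by (rule fam_closed_binary) (simp_all add: ring_hom_add[OF transfer_hom] ring_hom_add[OF reduce_hom])
  have minus: "(\<lambda>j. \<ominus>\<^bsub>\<O>' j\<^esub> f j) \<in> carrier fam" if "f \<in> carrier fam" for f
    using that
  proof (rule fam_closed_unary)
    fix i n x y assume n: "n \<le> e i" and xy: "x \<in> carrier (\<O>' (enat i))" "y \<in> carrier (\<O>' \<infinity>)" "transfer i n x = reduce n y"
    interpret T: ring_hom_ring "\<O>' (enat i)" "quot n" "transfer i n"
      by (rule ring_hom_ringI2[OF ring_O ring_quot transfer_hom[OF n]])
    interpret Q: ring_hom_ring "\<O>' \<infinity>" "quot n" "reduce n"
      by (rule ring_hom_ringI2[OF ring_O ring_quot reduce_hom])
    show "transfer i n (\<ominus>\<^bsub>\<O>' (enat i)\<^esub> x) = reduce n (\<ominus>\<^bsub>\<O>' \<infinity>\<^esub> y)"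
      using xy by simp
  qed simp
  have one: "(\<lambda>j. \<one>\<^bsub>\<O>' j\<^esub>) \<in> carrier fam"
    by (rule fam_carrierI) (simp_all add: ring_hom_one[OF transfer_hom] ring_hom_one[OF reduce_hom])
  have zero: "(\<lambda>j. \<zero>\<^bsub>\<O>' j\<^esub>) \<in> carrier fam"
    by (rule fam_carrierI) (simp_all add: ring_hom_zero[OF transfer_hom ring_O ring_quot]
        ring_hom_zero[OF reduce_hom ring_O ring_quot])
  show ?thesis
  proof (rule cringI)
    show "abelian_group fam"
    proof (rule abelian_groupI)
      fix f assume f: "f \<in> carrier fam"
      show "\<exists>g\<in>carrier fam. g \<oplus>\<^bsub>fam\<^esub> f = \<zero>\<^bsub>fam\<^esub>"
        by (rule bexI[OF _ minus[OF f]]) (simp add: ops cl[OF f] D.l_neg)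
    qed (auto simp: ops add zero cl D.a_ac)
    show "comm_monoid fam"
      by (rule comm_monoidI) (auto simp: ops mult one cl D.m_ac)
  qed (auto simp: ops cl D.l_distr)
qed

lemma ev_hom: "ev j \<in> ring_hom fam (\<O>' j)"
  by (rule ring_hom_memI) (auto simp: ev_def family_ring_def)

lemma ev_surj: "ev j ` carrier fam = carrier (\<O>' j)"
proof
  show "ev j ` carrier fam \<subseteq> carrier (\<O>' j)"
    using ring_hom_closed[OF ev_hom] by auto
  show "carrier (\<O>' j) \<subseteq> ev j ` carrier fam"
  proof
    fix x assume x: "x \<in> carrier (\<O>' j)"
    have "\<exists>f\<in>carrier fam. f j = x"
    proof (cases j)
      case (enat k)
      \<comment> \<open>Membership is an eventual condition, so a single component at a finite index
        may be chosen freely.\<close>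
      let ?f = "(\<lambda>j. \<zero>\<^bsub>\<O>' j\<^esub>)(j := x)"
      have "?f \<in> carrier fam"
      proof (rule fam_carrierI)
        show "?f i \<in> carrier (\<O>' i)" for i
          using x by (simp add: ring_O ring.ring_simprules)
        have "eventually (\<lambda>i. k < i) sequentially" by (rule eventually_gt_at_top)
        then show "eventually (\<lambda>i. n \<le> e i \<longrightarrow> transfer i n (?f (enat i)) = reduce n (?f \<infinity>)) sequentially" for n
          by eventually_elim (auto simp: enat ring_hom_zero[OF transfer_hom ring_O ring_quot]
            ring_hom_zero[OF reduce_hom ring_O ring_quot])
      qed
      then show ?thesis by (intro bexI[of _ ?f]) auto
    next
      case infinity
      \<comment> \<open>The component at infinity constrains almost all others, so each of them is
        chosen as a lift of x modulo the \<open>e i\<close>-th power.\<close>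
      have "\<exists>y\<in>carrier (\<O>' (enat i)). \<forall>n\<le>e i. transfer i n y = reduce n x" for i
        using transfer_surj[of x i] x infinity by metis
      then obtain y where y: "\<And>i. y i \<in> carrier (\<O>' (enat i))"
        "\<And>i n. n \<le> e i \<Longrightarrow> transfer i n (y i) = reduce n x"
        by metis
      let ?f = "\<lambda>i. case i of enat k \<Rightarrow> y k | \<infinity> \<Rightarrow> x"
      have "?f \<in> carrier fam"
        using x y infinity by (intro fam_carrierI) (auto split: enat.split)
      then show ?thesis
        using infinity by (intro bexI[of _ ?f]) auto
    qed
    then show "x \<in> ev j ` carrier fam" by (auto simp: ev_def)
  qed
qed

lemma ev_pow: "ev j (\<pi> [^]\<^bsub>fam\<^esub> (k::nat)) = \<pi> j [^]\<^bsub>\<O>' j\<^esub> k"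
  by (induction k) (simp_all add: ev_def family_ring_def nat_pow_def)

text \<open>At infinity the uniformizer is the image of X: nonzero because \<open>\<iota>\<close> is
  injective, and of valuation 1, the subdegree of X.\<close>

lemma \<pi>_in_O: "\<pi> j \<in> carrier (\<O>' j)" "\<pi> j \<noteq> \<zero>\<^bsub>\<O>' j\<^esub>"
proof -
  have "\<pi> j \<in> carrier (E j) - {\<zero>\<^bsub>E j\<^esub>} \<and> v j (\<pi> j) = 1"
  proof (cases j)
    case (enat i)
    then show ?thesis using unif by simp
  next
    case infinity
    interpret L: nonarch_local_field "E \<infinity>" "v \<infinity>" by (rule local_field)
    have bij: "bij_betw \<iota> UNIV (carrier (E \<infinity>))"
      using laurent by (simp add: ring_iso_def ring_of_type_algebra_def)
    have "\<iota> \<in> ring_hom (ring_of_type_algebra :: 'k fls ring) (E \<infinity>)"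
      using laurent by (simp add: ring_iso_def)
    then have "\<iota> 0 = \<zero>\<^bsub>E \<infinity>\<^esub>"
      using ring_hom_zero[OF _ ring_from_type_algebra L.ring_axioms]
      by (simp add: ring_of_type_algebra_def)
    moreover have "\<iota> fls_X \<noteq> \<iota> 0"
      using bij by (simp add: bij_betw_def inj_eq)
    ultimately show ?thesis
      using bij laurent_val[of fls_X] infinity unif_infinity by (auto simp: bij_betw_def)
  qed
  then show "\<pi> j \<in> carrier (\<O>' j)" "\<pi> j \<noteq> \<zero>\<^bsub>\<O>' j\<^esub>"
    by (auto simp: val_ring_def)
qed

end

section \<open>Comparison of the Witt vector functors\<close>

theorem proposition3p7:
  fixes p q :: nat
    and E :: "enat \<Rightarrow> 'a ring"
    and v :: "enat \<Rightarrow> 'a \<Rightarrow> int"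
    and \<iota> :: "'k :: {field, finite} fls \<Rightarrow> 'a"
    and e :: "nat \<Rightarrow> nat"
    and \<phi> \<psi> :: "nat \<Rightarrow> 'a set \<Rightarrow> 'a set"
    and \<pi> :: "enat \<Rightarrow> 'a"
    and \<O> :: "(enat \<Rightarrow> 'a) ring"
    and W :: "(enat \<Rightarrow> 'a, 'u) module \<Rightarrow> (enat \<Rightarrow> 'a, nat \<Rightarrow> 'u) module"
    and i :: enat
    and \<O>\<^sub>i :: "'a ring"
    and W\<^sub>i :: "('a, 'u) module \<Rightarrow> ('a, nat \<Rightarrow> 'u) module"
  assumes "close_local_fields p q E v \<iota> e \<phi> \<psi> \<pi>"
    and "\<O> = family_ring E v e \<phi>"
    and "\<O>\<^sub>i = val_ring (E i) (v i)"
    and "carrier \<O> \<lesssim> (UNIV :: 'u set)"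
    and "witt_functor \<O> \<pi> q W"
    and "witt_functor \<O>\<^sub>i (\<pi> i) q W\<^sub>i"
  shows "\<exists>\<theta> :: ('a, 'u) module \<Rightarrow> (nat \<Rightarrow> 'u) \<Rightarrow> (nat \<Rightarrow> 'u).
    (\<forall>A. algebra \<O>\<^sub>i A \<longrightarrow>
       \<theta> A \<in> alg_iso \<O> (W (restrict_scalars (ev i) A)) (restrict_scalars (ev i) (W\<^sub>i A))) \<and>
    (\<forall>A B h. algebra \<O>\<^sub>i A \<longrightarrow> algebra \<O>\<^sub>i B \<longrightarrow> h \<in> alg_hom \<O>\<^sub>i A B \<longrightarrow>
       (\<forall>a \<in> carrier (W (restrict_scalars (ev i) A)).
          \<theta> B (\<lambda>n. h (a n)) = (\<lambda>n. h (\<theta> A a n))))"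
proof -
  interpret C: close_local_fields p q E v \<iota> e \<phi> \<psi> \<pi> by fact
  have "carrier \<O>\<^sub>i \<lesssim> carrier \<O>"
    using image_lepoll[of "ev i" "carrier \<O>"] C.ev_surj[of i] assms by simp
  then have small: "carrier \<O>\<^sub>i \<lesssim> (UNIV :: 'u set)"
    using assms(4) lepoll_trans by blast
  have "infinite (carrier \<O>\<^sub>i)"
    using nonarch_local_field.val_ring_infinite[OF C.local_field] assms by simp
  then have "infinite (UNIV :: 'u set)"
    using small by (auto simp: lepoll_def dest: inj_on_finite)
  then interpret witt_base_change \<O> \<O>\<^sub>i "ev i" \<pi> "\<pi> i" q W W\<^sub>i
    using small assms C.cring_fam C.domain_O C.ev_hom C.ev_pow C.\<pi>_in_O
    by (intro witt_base_change.intro) simp_all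
  show ?thesis
    using id_alg_iso by (intro exI[of _ "\<lambda>A a. a"]) auto
qed

end
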